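(* Assume the Strong Exponential Time Hypothesis (SETH). Then there is no $\varepsilon > 0$ such that \textsc{Dominating Set} on a (not necessarily planar) graph $G$ given together with a linear layout of $G$ of cutwidth $k$ can be solved in time $\mathcal{O}^*((3-\varepsilon)^k)$.
   Context: All graphs are finite, simple and undirected. A set $S\subseteq V(G)$ is a dominating set if every vertex of $G$ is in $S$ or has a neighbor in $S$. \textsc{Dominating Set}: given a graph $G$ and an integer $t$, decide whether $G$ has a dominating set of size $t$. For an $n$-vertex graph $G$, a linear layout is a bijection $\pi\colon V(G)\to[n]$; its cutwidth is $\mathrm{ctw}_\pi(G)=\max_{1\le i<n}|\{\{u,v\}\in E(G): \pi(u)\le i<\pi(v)\}|$. The notation $\mathcal{O}^*(f(k))$ means $\mathcal{O}(f(k)\cdot N^{\mathcal{O}(1)})$ where $N$ is the input size. SETH: for every $\varepsilon>0$ there is a constant $q$ such that $q$-SAT (satisfiability of CNF formulas with clauses of size at most $q$) on $n$ variables cannot be solved in time $\mathcal{O}^*((2-\varepsilon)^n)$. *)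

theory Defs
  imports Complex_Main "HOL-Library.Discrete_Functions"
begin

section \<open>Random access machines with logarithmic cost\<close>

text \<open>
  Programs are RAM programs in structured form: finitely many registers and an unbounded memory,
  both holding natural numbers, with indirect addressing.  Subtraction is truncated and
  \<^term>\<open>a div 0 = 0\<close>.  Every operation is charged the bit lengths of its operands, of its result and
  of the memory addresses it uses.  Up to factors polylogarithmic in the running time, which
  \<open>O\<^sup>*\<close> absorbs for time bounds of the form \<open>2^poly(N)\<close>, this agrees with the word RAM.
\<close>

datatype expr =
    Const nat
  | Reg nat
  | Mem expr
  | Add expr expr
  | Sub expr expr
  | Mul expr expr
  | Div expr expr

datatype prog =
    Skip
  | Assign nat expr
  | Store expr expr
  | Seq prog prog
  | Cond expr prog prog
  | While expr prog

type_synonym state = "(nat \<Rightarrow> nat) \<times> (nat \<Rightarrow> nat)"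

definition bits :: "nat \<Rightarrow> nat" where
  "bits n = floor_log n + 1"

fun val :: "expr \<Rightarrow> state \<Rightarrow> nat" where
  "val (Const n) s = n"
| "val (Reg r) s = fst s r"
| "val (Mem a) s = snd s (val a s)"
| "val (Add a b) s = val a s + val b s"
| "val (Sub a b) s = val a s - val b s"
| "val (Mul a b) s = val a s * val b s"
| "val (Div a b) s = val a s div val b s"

text \<open>The cost of an expression is at least the bit length of its value, so in each clause the
  operands (for \<^const>\<open>Mem\<close>, the address) are already charged by the recursive calls.\<close>

fun cost :: "expr \<Rightarrow> state \<Rightarrow> nat" where
  "cost (Const n) s = bits n"
| "cost (Reg r) s = bits (fst s r)"
| "cost (Mem a) s = cost a s + bits (val (Mem a) s)"
| "cost (Add a b) s = cost a s + cost b s + bits (val (Add a b) s)"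
| "cost (Sub a b) s = cost a s + cost b s + bits (val (Sub a b) s)"
| "cost (Mul a b) s = cost a s + cost b s + bits (val (Mul a b) s)"
| "cost (Div a b) s = cost a s + cost b s + bits (val (Div a b) s)"

text \<open>\<open>exec p s t s'\<close>: started in \<open>s\<close>, program \<open>p\<close> halts in \<open>s'\<close> after time \<open>t\<close>.  Tests succeed on
  nonzero values.\<close>

inductive exec :: "prog \<Rightarrow> state \<Rightarrow> nat \<Rightarrow> state \<Rightarrow> bool" where
  Skip: "exec Skip s 1 s"
| Assign: "exec (Assign r e) s (cost e s) ((fst s)(r := val e s), snd s)"
| Store: "exec (Store a e) s (cost a s + cost e s) (fst s, (snd s)(val a s := val e s))"
| Seq: "exec p s t s' \<Longrightarrow> exec q s' u s'' \<Longrightarrow> exec (Seq p q) s (t + u) s''"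
| CondTrue: "val e s \<noteq> 0 \<Longrightarrow> exec p s t s' \<Longrightarrow> exec (Cond e p q) s (cost e s + t) s'"
| CondFalse: "val e s = 0 \<Longrightarrow> exec q s t s' \<Longrightarrow> exec (Cond e p q) s (cost e s + t) s'"
| WhileFalse: "val e s = 0 \<Longrightarrow> exec (While e p) s (cost e s) s"
| WhileTrue: "val e s \<noteq> 0 \<Longrightarrow> exec p s t s' \<Longrightarrow> exec (While e p) s' u s'' \<Longrightarrow>
    exec (While e p) s (cost e s + t + u) s''"

inductive_cases exec_SkipE: "exec Skip s t s'"
inductive_cases exec_AssignE: "exec (Assign r e) s t s'"
inductive_cases exec_StoreE: "exec (Store a e) s t s'"
inductive_cases exec_SeqE: "exec (Seq p q) s t s'"
inductive_cases exec_CondE: "exec (Cond e p q) s t s'"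
inductive_cases exec_WhileE: "exec (While e p) s t s'"

lemma exec_deterministic:
  "exec p s t s' \<Longrightarrow> exec p s u s'' \<Longrightarrow> u = t \<and> s'' = s'"
proof (induction arbitrary: u s'' rule: exec.induct)
  case (Seq p s t s' q u' s2)
  from Seq.prems show ?case
    by (rule exec_SeqE) (metis Seq.IH)
next
  case (CondTrue e s p t s' q)
  from CondTrue.prems show ?case
    by (rule exec_CondE) (metis CondTrue.IH, use CondTrue.hyps in simp)
next
  case (CondFalse e s q t s' p)
  from CondFalse.prems show ?case
    by (rule exec_CondE) (use CondFalse.hyps in simp, metis CondFalse.IH)
next
  case (WhileFalse e s p)
  from WhileFalse.prems show ?case
    by (rule exec_WhileE) (simp, use WhileFalse.hyps in simp)
next
  case (WhileTrue e s p t s' u' s2)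
  from WhileTrue.prems show ?case
    by (rule exec_WhileE) (use WhileTrue.hyps in simp, metis WhileTrue.IH)
qed (auto elim: exec_SkipE exec_AssignE exec_StoreE)

text \<open>The input is a list of numbers at the start of an otherwise zero memory; the answer is read
  from register 0.\<close>

definition start :: "nat list \<Rightarrow> state" where
  "start xs = (\<lambda>_. 0, \<lambda>i. if i < length xs then xs ! i else 0)"

definition input_size :: "nat list \<Rightarrow> nat" where
  "input_size xs = sum_list (map bits xs)"

definition decides_within ::
  "prog \<Rightarrow> 'i set \<Rightarrow> ('i \<Rightarrow> nat list) \<Rightarrow> ('i \<Rightarrow> bool) \<Rightarrow> ('i \<Rightarrow> real) \<Rightarrow> bool" where
  "decides_within p I enc yes T \<longleftrightarrow>
     (\<forall>x\<in>I. \<exists>t s. exec p (start (enc x)) t s \<and> (fst s 0 \<noteq> 0 \<longleftrightarrow> yes x) \<and> real t \<le> T x)"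

text \<open>Solvability in time \<open>O\<^sup>*(f(k))\<close>, where \<open>k\<close> is the value of \<open>param\<close> on the instance.\<close>

definition solvable_Ostar ::
  "'i set \<Rightarrow> ('i \<Rightarrow> nat list) \<Rightarrow> ('i \<Rightarrow> bool) \<Rightarrow> ('i \<Rightarrow> nat) \<Rightarrow> (nat \<Rightarrow> real) \<Rightarrow> bool" where
  "solvable_Ostar I enc yes param f \<longleftrightarrow>
     (\<exists>p (C::real) (c::nat). C > 0 \<and>
        decides_within p I enc yes (\<lambda>x. C * (f (param x) * real (input_size (enc x)) ^ c)))"

section \<open>Satisfiability and SETH\<close>

text \<open>A CNF formula is given by its number \<open>n\<close> of variables, which are \<open>0, \<dots>, n - 1\<close>, and its
  clauses; the literal \<open>(v, b)\<close> is satisfied iff \<open>v\<close> has value \<open>b\<close>.\<close>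

type_synonym clause = "(nat \<times> bool) list"
type_synonym cnf = "nat \<times> clause list"

definition qsat_instances :: "nat \<Rightarrow> cnf set" where
  "qsat_instances q =
     {(n, cs). \<forall>c\<in>set cs. length c \<le> q \<and> (\<forall>(v, b)\<in>set c. v < n)}"

definition satisfiable :: "cnf \<Rightarrow> bool" where
  "satisfiable \<phi> \<longleftrightarrow>
     (\<exists>\<alpha> :: nat \<Rightarrow> bool. \<forall>c\<in>set (snd \<phi>). \<exists>(v, b)\<in>set c. \<alpha> v = b)"

definition encode_cnf :: "cnf \<Rightarrow> nat list" where
  "encode_cnf = (\<lambda>(n, cs). [n, length cs] @
     concat (map (\<lambda>c. length c # map (\<lambda>(v, b). 2 * v + of_bool b) c) cs))"

definition num_vars :: "cnf \<Rightarrow> nat" where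
  "num_vars = fst"

definition SETH :: bool where
  "SETH \<longleftrightarrow> (\<forall>\<epsilon>::real. \<epsilon> > 0 \<longrightarrow>
     (\<exists>q. \<not> solvable_Ostar (qsat_instances q) encode_cnf satisfiable num_vars (\<lambda>n. (2 - \<epsilon>) ^ n)))"

section \<open>Graphs, dominating sets and cutwidth\<close>

definition simple_graph :: "'a set \<Rightarrow> 'a set set \<Rightarrow> bool" where
  "simple_graph V E \<longleftrightarrow> finite V \<and> (\<forall>e\<in>E. \<exists>u\<in>V. \<exists>v\<in>V. u \<noteq> v \<and> e = {u, v})"

definition dominating_set :: "'a set \<Rightarrow> 'a set set \<Rightarrow> 'a set \<Rightarrow> bool" where
  "dominating_set V E S \<longleftrightarrow> S \<subseteq> V \<and> (\<forall>v\<in>V. v \<in> S \<or> (\<exists>u\<in>S. {u, v} \<in> E))"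

definition linear_layout :: "'a set \<Rightarrow> ('a \<Rightarrow> nat) \<Rightarrow> bool" where
  "linear_layout V \<pi> \<longleftrightarrow> bij_betw \<pi> V {1..card V}"

text \<open>The inserted 0 only matters for graphs with at most one vertex, where there are no cuts.\<close>

definition cutwidth :: "'a set \<Rightarrow> 'a set set \<Rightarrow> ('a \<Rightarrow> nat) \<Rightarrow> nat" where
  "cutwidth V E \<pi> = Max (insert 0
     ((\<lambda>i. card {e\<in>E. \<exists>u v. e = {u, v} \<and> \<pi> u \<le> i \<and> i < \<pi> v}) ` {1..<card V}))"

text \<open>An instance \<open>(n, es, ps, t)\<close> consists of a graph on the vertices \<open>0, \<dots>, n - 1\<close> whose edges are
  listed without repetition in \<open>es\<close>, the layout mapping \<open>v\<close> to \<open>ps ! v\<close>, and the target size \<open>t\<close>.\<close>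

type_synonym ds_instance = "nat \<times> (nat \<times> nat) list \<times> nat list \<times> nat"

definition verts :: "ds_instance \<Rightarrow> nat set" where
  "verts = (\<lambda>(n, es, ps, t). {..<n})"

definition edges :: "ds_instance \<Rightarrow> nat set set" where
  "edges = (\<lambda>(n, es, ps, t). (\<lambda>(u, v). {u, v}) ` set es)"

definition layout :: "ds_instance \<Rightarrow> nat \<Rightarrow> nat" where
  "layout = (\<lambda>(n, es, ps, t) v. ps ! v)"

definition ds_instances :: "ds_instance set" where
  "ds_instances = {x. case x of (n, es, ps, t) \<Rightarrow>
     simple_graph (verts x) (edges x) \<and> distinct (map (\<lambda>(u, v). {u, v}) es) \<and>
     length ps = n \<and> linear_layout (verts x) (layout x)}"

definition has_dominating_set :: "ds_instance \<Rightarrow> bool" where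
  "has_dominating_set x = (case x of (n, es, ps, t) \<Rightarrow>
     \<exists>S. dominating_set (verts x) (edges x) S \<and> card S = t)"

definition encode_ds :: "ds_instance \<Rightarrow> nat list" where
  "encode_ds = (\<lambda>(n, es, ps, t).
     [n, length es, t] @ concat (map (\<lambda>(u, v). [u, v]) es) @ ps)"

definition layout_cutwidth :: "ds_instance \<Rightarrow> nat" where
  "layout_cutwidth x = cutwidth (verts x) (edges x) (layout x)"

end

theory Submission imports Defs begin

text \<open>
  For \<open>3 - \<epsilon> < 3\<close> choose \<open>p\<close> and \<open>\<beta>\<close> with \<open>(3 - \<epsilon>)^p < 2^\<beta> \<le> 3^p\<close> and encode each group of \<open>\<beta>\<close>
  variables by the states of \<open>p\<close> long paths that cross every cut of the layout in at most one edge each.  A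
  dominating set within the budget picks exactly one of the three vertices that a path has in each
  column, and along a path this choice changes monotonically, hence at most twice.  Since all clauses
  are checked more often than there can be changes, in some round no state changes.  As clauses have
  bounded size, each of them is checked by vertices of bounded degree, which add only a constant to
  the cutwidth.  The construction is carried out by a RAM program.  Since the number \<open>n\<close> of variables
  is written in binary, its running time is polynomial in \<open>n\<close> plus the input size only; the
  factor polynomial in \<open>n\<close> is absorbed by the gap between \<open>(3 - \<epsilon>)^(p/\<beta>)\<close> and 2.
\<close>

section \<open>Reasoning about RAM programs\<close>

text \<open>Why the three states behave monotonically: choosing the end 0 in a column leaves the end
  2 to the next column, which must then choose its 0; choosing 2 leaves the end 0 to the previous
  column, which must have chosen its 2; the middle vertex 1 forces nothing. States can therefore
  only fall, and nothing forbids a fall, so checking every clause once would not do.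

  The obstacle for the checks is that a single vertex can only express a disjunction of the form
  "one of these choices was made", whereas the truth of a literal depends on all \<open>p\<close>
  paths of its group jointly. Guessing resolves this: for a fixed guess of the group states, "the
  guess is wrong at some path, or it makes some literal true" is such a disjunction, and its
  conjunction over all guesses is the clause. The price is a factor \<open>3 ^ (p * q)\<close> in
  the number of columns, not in the cutwidth.

  The order of choices matters: \<open>p\<close> and \<open>\<beta>\<close> depend on \<epsilon>
  only, SETH then supplies \<open>q\<close>, so that \<open>3 ^ (p * q)\<close> and the additive
  term \<open>3 * (p * q)\<close> in the cutwidth are constants.\<close>

lemma bits_le: "x < 2 ^ k \<Longrightarrow> 0 < k \<Longrightarrow> bits x \<le> k"
proof (cases "x = 0")
  case False
  assume *: "x < 2 ^ k"
  have "2 ^ floor_log x \<le> x" using False by (simp add: floor_log_exp2_le)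
  then have "(2::nat) ^ floor_log x < 2 ^ k" using * by linarith
  then show ?thesis by (simp add: bits_def)
qed (simp add: bits_def)

lemma bits_pos: "0 < bits x"
  by (simp add: bits_def)

lemma less_exp_bits: "x < 2 ^ bits x"
  using floor_log_exp2_gt[of x] by (simp add: bits_def)

text \<open>One word length for the whole machine: logarithmic costs then become multiples of
  \<open>b\<close>, with a factor that depends on the program text only.\<close>

definition bnd :: "nat \<Rightarrow> state \<Rightarrow> bool" where
  "bnd b s \<longleftrightarrow> 0 < b \<and> (\<forall>r. fst s r < 2 ^ b) \<and> (\<forall>i. snd s i < 2 ^ b)"

text \<open>The factor 3 pays once for the operands and twice for the result, which fits into twice
  the operands' total length. \<open>Mem\<close> adds only 1 because every memory cell is below
  \<open>2 ^ b\<close>, however long its address.\<close>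

fun weight :: "expr \<Rightarrow> nat" where
  "weight (Const n) = bits n"
| "weight (Reg r) = 1"
| "weight (Mem a) = weight a + 1"
| "weight (Add a b) = 3 * (weight a + weight b)"
| "weight (Sub a b) = 3 * (weight a + weight b)"
| "weight (Mul a b) = 3 * (weight a + weight b)"
| "weight (Div a b) = 3 * (weight a + weight b)"

lemma weight_pos: "0 < weight e"
  by (induction e) (simp_all add: bits_pos)

lemma nat_op_less_exp:
  assumes "x < (2::nat) ^ i" "y < 2 ^ j" "0 < i"
  shows "x + y < 2 ^ (2 * (i + j))" "x - y < 2 ^ (2 * (i + j))"
    "x * y < 2 ^ (2 * (i + j))" "x div y < 2 ^ (2 * (i + j))"
proof -
  have mono: "(2::nat) ^ k \<le> 2 ^ (2 * (i + j))" if "k \<le> 2 * (i + j)" for k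
    using that by (intro power_increasing) auto
  have "x < 2 ^ (i + j)" "y < 2 ^ (i + j)"
    by (rule order.strict_trans2[OF assms(1)] order.strict_trans2[OF assms(2)],
        intro power_increasing, auto)+
  then have "x + y < 2 ^ Suc (i + j)" by simp
  moreover have le: "Suc (i + j) \<le> 2 * (i + j)" using assms(3) by presburger
  ultimately show "x + y < 2 ^ (2 * (i + j))" using mono[OF le] by linarith
  have "x * y < 2 ^ i * 2 ^ j" using assms by (intro mult_strict_mono) auto
  then show "x * y < 2 ^ (2 * (i + j))"
    using mono[of "i + j"] by (simp add: power_add)
  have "x < 2 ^ (2 * (i + j))" using order.strict_trans2[OF assms(1) mono[of i]] by simp
  then show "x - y < 2 ^ (2 * (i + j))" "x div y < 2 ^ (2 * (i + j))"
    using div_le_dividend[of x y] by linarith+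
qed

lemma val_cost_le:
  assumes "bnd b s"
  shows "val e s < 2 ^ (weight e * b) \<and> cost e s \<le> weight e * b"
proof -
  have b: "0 < b" using assms by (simp add: bnd_def)
  have op: "v < 2 ^ (3 * (weight x + weight y) * b) \<and>
      cost x s + cost y s + bits v \<le> 3 * (weight x + weight y) * b"
    if "v < 2 ^ (2 * (weight x * b + weight y * b))"
      "cost x s \<le> weight x * b" "cost y s \<le> weight y * b" for v x y
  proof -
    have "(2::nat) ^ (2 * (weight x * b + weight y * b)) \<le> 2 ^ (3 * (weight x + weight y) * b)"
      by (intro power_increasing) (auto simp: algebra_simps)
    moreover have "bits v \<le> 2 * (weight x * b + weight y * b)"
      using that(1) weight_pos[of x] b by (intro bits_le) auto
    moreover have "3 * (weight x + weight y) * b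
        = weight x * b + weight y * b + 2 * (weight x * b + weight y * b)"
      by (simp add: algebra_simps)
    ultimately show ?thesis using that by linarith
  qed
  have pos: "0 < weight x * b" for x
    using b weight_pos[of x] by simp
  show ?thesis
  proof (induction e)
    case (Const n)
    have "n < 2 ^ bits n" by (rule less_exp_bits)
    also have "\<dots> \<le> 2 ^ (bits n * b)" using b by (intro power_increasing) auto
    finally show ?case using b by simp
  next
    case (Reg r)
    show ?case using assms b by (auto simp: bnd_def intro: bits_le)
  next
    case (Mem a)
    have *: "snd s (val a s) < 2 ^ b" using assms by (simp add: bnd_def)
    also have "\<dots> \<le> 2 ^ (weight (Mem a) * b)" by (intro power_increasing) auto
    finally show ?case using Mem bits_le[OF * b] by simp
  next
    case (Add x y)
    then show ?case
      using op[OF nat_op_less_exp(1)[of "val x s" _ "val y s"], of x y] pos[of x]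
      by simp
  next
    case (Sub x y)
    then show ?case
      using op[OF nat_op_less_exp(2)[of "val x s" _ "val y s"], of x y] pos[of x]
      by simp
  next
    case (Mul x y)
    then show ?case
      using op[OF nat_op_less_exp(3)[of "val x s" _ "val y s"], of x y] pos[of x]
      by simp
  next
    case (Div x y)
    then show ?case
      using op[OF nat_op_less_exp(4)[of "val x s" _ "val y s"], of x y] pos[of x]
      by simp
  qed
qed

lemma cost_le: "bnd b s \<Longrightarrow> cost e s \<le> weight e * b"
  using val_cost_le by blast

text \<open>Time in units of the word length; only an upper bound is kept, so bounds add up along a
  program without reference to the states passed.\<close>

definition run :: "nat \<Rightarrow> prog \<Rightarrow> state \<Rightarrow> nat \<Rightarrow> state \<Rightarrow> bool" where
  "run b p s T s' \<longleftrightarrow> (\<exists>t. exec p s t s' \<and> t \<le> T * b)"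

lemma run_Skip: "bnd b s \<Longrightarrow> run b Skip s 1 s"
  unfolding run_def bnd_def using exec.Skip by fastforce

lemma run_Assign:
  "bnd b s \<Longrightarrow> s' = ((fst s)(r := val e s), snd s) \<Longrightarrow> run b (Assign r e) s (weight e) s'"
  unfolding run_def by (blast intro: exec.Assign cost_le)

lemma run_Store:
  "bnd b s \<Longrightarrow> s' = (fst s, (snd s)(val a s := val e s)) \<Longrightarrow>
    run b (Store a e) s (weight a + weight e) s'"
  unfolding run_def add_mult_distrib by (blast intro: exec.Store cost_le add_mono)

lemma run_Seq: "run b p s T s' \<Longrightarrow> run b q s' U s'' \<Longrightarrow> run b (Seq p q) s (T + U) s''"
  unfolding run_def add_mult_distrib by (blast intro: exec.Seq add_mono)

lemma run_Cond_True:
  "bnd b s \<Longrightarrow> val e s \<noteq> 0 \<Longrightarrow> run b p s T s' \<Longrightarrow> run b (Cond e p q) s (weight e + T) s'"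
  unfolding run_def add_mult_distrib by (blast intro: exec.CondTrue cost_le add_mono)

lemma run_Cond_False:
  "bnd b s \<Longrightarrow> val e s = 0 \<Longrightarrow> run b q s T s' \<Longrightarrow> run b (Cond e p q) s (weight e + T) s'"
  unfolding run_def add_mult_distrib by (blast intro: exec.CondFalse cost_le add_mono)

lemma run_mono: "run b p s T s' \<Longrightarrow> T \<le> U \<Longrightarrow> run b p s U s'"
  unfolding run_def by (meson le_trans mult_le_mono1)

text \<open>The induction counts the iterations still to come, since \<open>WhileTrue\<close> adds
  an iteration at the front. The sequence \<open>\<sigma>\<close> serves as the loop
  invariant.\<close>

lemma run_While:
  assumes "\<And>i. i \<le> k \<Longrightarrow> bnd b (\<sigma> i)"
    and "\<And>i. i < k \<Longrightarrow> val e (\<sigma> i) \<noteq> 0"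
    and "val e (\<sigma> k) = 0"
    and "\<And>i. i < k \<Longrightarrow> run b p (\<sigma> i) T (\<sigma> (Suc i))"
  shows "run b (While e p) (\<sigma> 0) (k * (weight e + T) + weight e) (\<sigma> k)"
proof -
  have "run b (While e p) (\<sigma> (k - j)) (j * (weight e + T) + weight e) (\<sigma> k)" if "j \<le> k" for j
    using that
  proof (induction j)
    case 0
    show ?case unfolding run_def
      using exec.WhileFalse[OF assms(3)] cost_le[OF assms(1)] by fastforce
  next
    case (Suc j)
    let ?i = "k - Suc j"
    have i: "?i < k" "Suc ?i = k - j" using Suc.prems by auto
    obtain t where t: "exec p (\<sigma> ?i) t (\<sigma> (k - j))" "t \<le> T * b"
      using assms(4)[OF i(1)] i(2) unfolding run_def by auto
    obtain u where u: "exec (While e p) (\<sigma> (k - j)) u (\<sigma> k)" "u \<le> (j * (weight e + T) + weight e) * b"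
      using Suc unfolding run_def by auto
    have "cost e (\<sigma> ?i) \<le> weight e * b" using assms(1) i(1) by (intro cost_le) auto
    with t(2) u(2) have "cost e (\<sigma> ?i) + t + u \<le> (Suc j * (weight e + T) + weight e) * b"
      by (simp add: algebra_simps)
    with exec.WhileTrue[OF assms(2)[OF i(1)] t(1) u(1)] show ?case
      unfolding run_def by blast
  qed
  from this[of k] show ?thesis by simp
qed

text \<open>Register files and memory segments are described by lists, so that assignments become list
  updates that the simplifier evaluates.\<close>

definition cells :: "nat list \<Rightarrow> nat \<Rightarrow> nat" where
  "cells xs = (\<lambda>i. if i < length xs then xs ! i else 0)"

text \<open>Models output written behind the input: a store just past the segment becomes an append
  to the list.\<close>

definition lay :: "(nat \<Rightarrow> nat) \<Rightarrow> nat \<Rightarrow> nat list \<Rightarrow> nat \<Rightarrow> nat" where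
  "lay \<mu> d xs = (\<lambda>i. if d \<le> i \<and> i < d + length xs then xs ! (i - d) else \<mu> i)"

lemma start_eq: "start xs = (cells [], cells xs)"
  by (simp add: start_def cells_def)

lemma cells_update: "r < length xs \<Longrightarrow> (cells xs)(r := v) = cells (xs[r := v])"
  by (auto simp: cells_def fun_eq_iff nth_list_update)

lemma cells_nth: "r < length xs \<Longrightarrow> cells xs r = xs ! r"
  by (simp add: cells_def)

lemma cells_Nil_eq: "cells [] = cells (replicate k 0)"
  by (auto simp: cells_def fun_eq_iff)

lemma lay_append: "(lay \<mu> d xs)(d + length xs := v) = lay \<mu> d (xs @ [v])"
  by (auto simp: lay_def fun_eq_iff nth_append)

lemma lay_update: "i < length xs \<Longrightarrow> (lay \<mu> d xs)(d + i := v) = lay \<mu> d (xs[i := v])"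
  by (auto simp: lay_def fun_eq_iff nth_list_update)

lemma lay_Nil: "lay \<mu> d [] = \<mu>"
  by (auto simp: lay_def)

lemma lay_less:
  assumes "\<forall>i. \<mu> i < B" "\<forall>x\<in>set xs. x < B" shows "lay \<mu> d xs i < B"
  using assms by (auto simp: lay_def)

subsection \<open>Expressions for arithmetic and Boolean operations\<close>

definition tr :: "expr \<Rightarrow> state \<Rightarrow> bool" where
  "tr e s \<longleftrightarrow> val e s \<noteq> 0"

definition ModE :: "expr \<Rightarrow> expr \<Rightarrow> expr" where
  "ModE a b = Sub a (Mul (Div a b) b)"

definition NeE :: "expr \<Rightarrow> expr \<Rightarrow> expr" where
  "NeE a b = Add (Sub a b) (Sub b a)"

definition EqE :: "expr \<Rightarrow> expr \<Rightarrow> expr" where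
  "EqE a b = Sub (Const 1) (NeE a b)"

definition LtE :: "expr \<Rightarrow> expr \<Rightarrow> expr" where
  "LtE a b = Sub b a"

text \<open>A bounded quantifier unrolled in the program text; its range is always one of the
  constants \<open>p\<close>, \<open>\<beta>\<close>, \<open>q\<close>.\<close>

fun ExE :: "nat \<Rightarrow> (nat \<Rightarrow> expr) \<Rightarrow> expr" where
  "ExE 0 f = Const 0"
| "ExE (Suc k) f = Add (ExE k f) (f k)"

lemma val_ModE: "val (ModE a b) s = val a s mod val b s"
  by (simp add: ModE_def minus_div_mult_eq_mod)

lemma tr_NeE: "tr (NeE a b) s \<longleftrightarrow> val a s \<noteq> val b s"
  by (auto simp: NeE_def tr_def)

lemma tr_EqE: "tr (EqE a b) s \<longleftrightarrow> val a s = val b s"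
  by (auto simp: EqE_def NeE_def tr_def)

lemma tr_LtE: "tr (LtE a b) s \<longleftrightarrow> val a s < val b s"
  by (auto simp: LtE_def tr_def)

lemma tr_Mul: "tr (Mul a b) s \<longleftrightarrow> tr a s \<and> tr b s"
  by (auto simp: tr_def)

lemma tr_Add: "tr (Add a b) s \<longleftrightarrow> tr a s \<or> tr b s"
  by (auto simp: tr_def)

lemma tr_ExE: "tr (ExE k f) s \<longleftrightarrow> (\<exists>i<k. tr (f i) s)"
  by (induction k) (auto simp: tr_Add less_Suc_eq, simp add: tr_def)

lemmas tr_simps = tr_NeE tr_EqE tr_LtE tr_Mul tr_Add tr_ExE val_ModE

section \<open>Digits\<close>

definition digits :: "nat \<Rightarrow> (nat \<Rightarrow> nat) \<Rightarrow> nat \<Rightarrow> nat" where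
  "digits B d k = (\<Sum>i<k. d i * B ^ i)"

lemma digits_Suc_shift: "digits B d (Suc k) = d 0 + B * digits B (\<lambda>i. d (Suc i)) k"
  unfolding digits_def by (subst sum.lessThan_Suc_shift) (simp add: sum_distrib_left mult_ac)

lemma digits_less:
  assumes "\<And>i. d i < B" shows "digits B d k < B ^ k"
proof (induction k)
  case (Suc k)
  have "digits B d (Suc k) < B ^ k + d k * B ^ k" using Suc by (simp add: digits_def)
  also have "\<dots> = Suc (d k) * B ^ k" by simp
  also have "\<dots> \<le> B * B ^ k" using assms[of k] by (intro mult_right_mono) auto
  finally show ?case by simp
qed (simp add: digits_def)

text \<open>Division drops the digits below position \<open>a\<close>, the remainder those from
  \<open>a + k\<close> on. With \<open>k = 1\<close> this reads one digit of a group code, with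
  \<open>k = p\<close> it cuts the guess for one literal out of a column number.\<close>

lemma digits_div_mod:
  assumes "\<And>i. d i < B" "a + k \<le> n"
  shows "digits B d n div B ^ a mod B ^ k = digits B (\<lambda>i. d (a + i)) k"
proof -
  have B: "0 < B" using assms(1)[of 0] by simp
  have split: "digits B d (a + j) = digits B d a + B ^ a * digits B (\<lambda>i. d (a + i)) j" for d a j
    unfolding digits_def
    by (induction j) (simp_all add: power_add algebra_simps)
  obtain r where n: "n = a + (k + r)" using assms(2) by (metis le_Suc_ex add.assoc)
  have "digits B d n div B ^ a = digits B (\<lambda>i. d (a + i)) (k + r)"
    unfolding n split using digits_less[of d B a] assms(1) B by simp
  then show ?thesis
    unfolding split using digits_less[of "\<lambda>i. d (a + i)" B k] assms(1) B by simp
qed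

lemma digits_of_number: "x < B ^ k \<Longrightarrow> digits B (\<lambda>i. x div B ^ i mod B) k = x"
proof (induction k arbitrary: x)
  case (Suc k)
  have "x div B < B ^ k" using Suc.prems by (metis less_mult_imp_div_less mult.commute power_Suc)
  from Suc.IH[OF this] show ?case
    by (simp add: digits_Suc_shift div_mult2_eq)
qed (simp add: digits_def)

lemma number_eq_digits:
  assumes "x < B ^ k" "y < B ^ k" "\<And>i. i < k \<Longrightarrow> x div B ^ i mod B = y div B ^ i mod B"
  shows "x = (y::nat)"
proof -
  have "digits B (\<lambda>i. x div B ^ i mod B) k = digits B (\<lambda>i. y div B ^ i mod B) k"
    unfolding digits_def using assms(3) by (intro sum.cong) auto
  then show ?thesis using digits_of_number assms(1,2) by metis
qed

section \<open>The graph of a formula\<close>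

text \<open>Groups of \<open>\<beta>\<close> variables are represented by \<open>p\<close> paths, each of which runs through all columns
  and has one of three states.  Column \<open>c\<close> contains, for each path \<open>i\<close>, the vertices \<open>vx c i a\<close>: those
  with \<open>a < 3\<close> lie on the path, and \<open>a = 3\<close> is a guard that forces one of the four into every
  dominating set.  The last vertex \<open>cx c\<close> of the column checks the clause with index
  \<open>c div 3 ^ (p * q) mod length cs\<close>; the base-\<open>3\<close> digits of \<open>c\<close> spell out the states of the groups
  of its literals that it excludes.\<close>

locale reduction =
  fixes p \<beta> q n :: nat and cs :: "clause list"
  assumes p_pos: "0 < p" and \<beta>_pos: "0 < \<beta>" and exp_le: "2 ^ \<beta> \<le> (3::nat) ^ p"
    and inst: "(n, cs) \<in> qsat_instances q"
begin

definition paths :: nat where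
  "paths = p * ((n + (\<beta> - 1)) div \<beta>)"

text \<open>The states can fall at most \<open>2 * paths\<close> times, so
  \<open>2 * paths + 1\<close> rounds include one without a change; the two further rounds are the
  first and the last, given up because monotonicity fails at the border columns. In a round every
  clause gets one column for each guess of \<open>q\<close> groups with \<open>p\<close> base-3
  digits.\<close>

definition cols :: nat where
  "cols = (2 * paths + 3) * length cs * 3 ^ (p * q)"

definition width :: nat where
  "width = 4 * paths + 1"

definition order :: nat where
  "order = cols * width"

definition clause_of :: "nat \<Rightarrow> clause" where
  "clause_of c = cs ! (c div 3 ^ (p * q) mod length cs)"

text \<open>Here \<open>z\<close> is the column's guess for the group of literal \<open>l\<close>. A
  path of that group dominates the checker if its state refutes its digit of the guess, or if the
  guess makes the literal true. Hence the checker is left undominated exactly if all guesses are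
  right and none satisfies its literal.\<close>

definition checks :: "nat \<Rightarrow> nat \<Rightarrow> nat \<Rightarrow> bool" where
  "checks c i a \<longleftrightarrow> (\<exists>l<length (clause_of c). let (v, b) = clause_of c ! l;
     z = c div 3 ^ (p * l) mod 3 ^ p in i div p = v div \<beta> \<and>
     (z div 3 ^ (i mod p) mod 3 \<noteq> a \<or> z div 2 ^ (v mod \<beta>) mod 2 = of_bool b))"

text \<open>Oriented from the smaller to the larger vertex. The four vertices of a path in a column
  form a complete graph without the edge between the ends 0 and 2, and end 2 is linked to end 0 of
  the next column, which lies \<open>width - 2\<close> further. In the first and last column the
  ends are adjacent as well: there no neighbouring column could dominate end 0 under state 2,
  respectively end 2 under state 0.\<close>

definition edge :: "nat \<Rightarrow> nat \<Rightarrow> bool" where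
  "edge u v \<longleftrightarrow> u < v \<and>
     (u div width = v div width \<and>
        (v mod width < 4 * paths \<and> u mod width div 4 = v mod width div 4 \<and>
           (u mod width mod 4 \<noteq> 0 \<or> v mod width mod 4 \<noteq> 2 \<or>
            u div width = 0 \<or> u div width + 1 = cols) \<or>
         v mod width = 4 * paths \<and> u mod width mod 4 \<noteq> 3 \<and>
           checks (u div width) (u mod width div 4) (u mod width mod 4)) \<or>
      v + 2 = u + width \<and> u mod width mod 4 = 2)"

definition vx :: "nat \<Rightarrow> nat \<Rightarrow> nat \<Rightarrow> nat" where
  "vx c i a = c * width + (4 * i + a)"

definition cx :: "nat \<Rightarrow> nat" where
  "cx c = c * width + 4 * paths"

text \<open>Edges are listed by scanning the numbers of all vertex pairs; the prefix parameter makes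
  this the invariant of the program's main loop.\<close>

definition pairs :: "nat \<Rightarrow> (nat \<times> nat) list" where
  "pairs k = map (\<lambda>x. (x div order, x mod order))
     (filter (\<lambda>x. edge (x div order) (x mod order)) [0..<k])"

definition graph :: ds_instance where
  "graph = (order, pairs (order * order), map Suc [0..<order], paths * cols)"

section \<open>Vertex coordinates, validity of the instance, and adjacency in coordinates\<close>

lemma width_pos: "0 < width"
  by (simp add: width_def)

lemma vx_div_mod:
  assumes "i < paths" "a < 4"
  shows "vx c i a div width = c" "vx c i a mod width = 4 * i + a"
proof -
  have "4 * i + a < width" using assms by (simp add: width_def)
  then show "vx c i a div width = c" "vx c i a mod width = 4 * i + a"
    unfolding vx_def by auto
qed

lemma cx_div_mod: "cx c div width = c" "cx c mod width = 4 * paths"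
proof -
  have "4 * paths < width" by (simp add: width_def)
  then show "cx c div width = c" "cx c mod width = 4 * paths"
    unfolding cx_def by auto
qed

lemma vx_inject:
  assumes "i < paths" "a < 4" "j < paths" "b < 4"
  shows "vx c i a = vx d j b \<longleftrightarrow> c = d \<and> i = j \<and> a = b"
proof
  assume eq: "vx c i a = vx d j b"
  have "c = d" "4 * i + a = 4 * j + b"
    using eq vx_div_mod[OF assms(1,2), of c] vx_div_mod[OF assms(3,4), of d] by auto
  then show "c = d \<and> i = j \<and> a = b" using assms by presburger
qed simp

lemma vx_neq_cx:
  assumes "i < paths" "a < 4" shows "vx c i a \<noteq> cx d"
proof
  assume "vx c i a = cx d"
  then have "4 * i + a = 4 * paths" using vx_div_mod(2)[OF assms, of c] cx_div_mod(2)[of d] by simp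
  then show False using assms by presburger
qed

lemma vertex_cases:
  assumes "u < order"
  obtains c i a where "c < cols" "i < paths" "a < 4" "u = vx c i a"
    | c where "c < cols" "u = cx c"
proof -
  have c: "u div width < cols"
    using assms unfolding order_def by (simp add: less_mult_imp_div_less)
  have u: "u = u div width * width + u mod width" by simp
  have "u mod width < width" using width_pos by simp
  then consider "u mod width < 4 * paths" | "u mod width = 4 * paths"
    unfolding width_def by linarith
  then show thesis
  proof cases
    case 1
    show thesis
      by (rule that(1)[OF c, of "u mod width div 4" "u mod width mod 4"])
        (use 1 u in \<open>auto simp: vx_def\<close>)
  next
    case 2
    show thesis by (rule that(2)[OF c]) (use 2 u in \<open>simp add: cx_def\<close>)
  qed
qed

lemma vx_less:
  assumes "c < cols" "i < paths" "a < 4" shows "vx c i a < order"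
proof -
  have "vx c i a < Suc c * width" using assms by (simp add: vx_def width_def)
  also have "\<dots> \<le> order" unfolding order_def using assms(1) by (intro mult_right_mono) auto
  finally show ?thesis .
qed

lemma cx_less:
  assumes "c < cols" shows "cx c < order"
proof -
  have "cx c < Suc c * width" by (simp add: cx_def width_def)
  also have "\<dots> \<le> order" unfolding order_def using assms(1) by (intro mult_right_mono) auto
  finally show ?thesis .
qed

lemma set_pairs: "set (pairs (order * order)) = {(u, v). u < order \<and> v < order \<and> edge u v}"
proof -
  have "(u, v) \<in> set (pairs (order * order))" if "u < order" "v < order" "edge u v" for u v
  proof -
    have "u * order + v < Suc u * order" using that by simp
    also have "\<dots> \<le> order * order" using that by (intro mult_right_mono) auto
    finally have "u * order + v < order * order" .
    moreover have "(u * order + v) div order = u" "(u * order + v) mod order = v"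
      using that by auto
    ultimately show ?thesis using that(3) unfolding pairs_def
      by (force intro!: image_eqI[of _ _ "u * order + v"])
  qed
  moreover have "x div order < order" "x mod order < order" if "x < order * order" for x
  proof -
    show "x div order < order" using that by (simp add: less_mult_imp_div_less)
    show "x mod order < order" using that by (metis mod_less_divisor mult_is_0 not_less_zero neq0_conv)
  qed
  ultimately show ?thesis unfolding pairs_def by auto
qed

lemma in_edges:
  "{u, v} \<in> edges graph \<longleftrightarrow> u < order \<and> v < order \<and> (edge u v \<or> edge v u)"
  unfolding edges_def graph_def set_pairs prod.case
  by (auto simp: doubleton_eq_iff set_pairs image_iff)

lemma verts_graph: "verts graph = {..<order}"
  by (simp add: verts_def graph_def)

lemma edge_less: "edge u v \<Longrightarrow> u < v"
  by (simp add: edge_def)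

lemma graph_in_ds_instances: "graph \<in> ds_instances"
proof -
  have "simple_graph (verts graph) (edges graph)"
    unfolding simple_graph_def verts_graph
  proof (intro conjI ballI)
    fix e assume "e \<in> edges graph"
    then obtain u v where "u < order" "v < order" "edge u v" "e = {u, v}"
      by (auto simp: edges_def graph_def set_pairs)
    moreover from this have "u \<noteq> v" using edge_less by blast
    ultimately show "\<exists>u\<in>{..<order}. \<exists>v\<in>{..<order}. u \<noteq> v \<and> e = {u, v}"
      by (intro bexI[of _ u] bexI[of _ v]) auto
  qed simp
  moreover have "distinct (map (\<lambda>(u, v). {u, v}) (pairs (order * order)))"
  proof -
    have "inj_on (\<lambda>x. (x div order, x mod order)) A" for A
      by (rule inj_onI) (metis Pair_inject div_mult_mod_eq)
    then have "distinct (pairs (order * order))"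
      unfolding pairs_def by (simp add: distinct_map)
    moreover have "inj_on (\<lambda>(u, v). {u, v}) (set (pairs (order * order)))"
    proof (rule inj_onI, clarsimp simp: set_pairs)
      fix u v u' v' assume "edge u v" "edge u' v'" "{u, v} = {u', v'}"
      with edge_less[of u v] edge_less[of u' v'] show "u = u' \<and> v = v'"
        by (auto simp: doubleton_eq_iff)
    qed
    ultimately show ?thesis by (simp add: distinct_map)
  qed
  moreover have "linear_layout (verts graph) (layout graph)"
  proof -
    have "bij_betw Suc {..<order} {1..card {..<order}}"
      by (simp add: bij_betw_def image_Suc_lessThan)
    moreover have "layout graph v = Suc v" if "v \<in> {..<order}" for v
      using that by (simp add: layout_def graph_def)
    ultimately show ?thesis unfolding linear_layout_def verts_graph
      using bij_betw_cong[of "{..<order}" "layout graph" Suc] by blast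
  qed
  ultimately show ?thesis unfolding ds_instances_def by (simp add: graph_def)
qed

lemma edge_vx_vx:
  assumes "i < paths" "a < 4" "j < paths" "b < 4"
  shows "edge (vx c i a) (vx d j b) \<longleftrightarrow>
    c = d \<and> i = j \<and> a < b \<and> (a \<noteq> 0 \<or> b \<noteq> 2 \<or> c = 0 \<or> c + 1 = cols) \<or>
    d = Suc c \<and> i = j \<and> a = 2 \<and> b = 0"
proof -
  note dm = vx_div_mod[OF assms(1,2), of c] vx_div_mod[OF assms(3,4), of d]
  have *: "(4 * i + a) div 4 = i" "(4 * i + a) mod 4 = a"
    "(4 * j + b) div 4 = j" "(4 * j + b) mod 4 = b" using assms by auto
  have "4 * j + b < 4 * paths" "4 * j + b \<noteq> 4 * paths" using assms by auto
  moreover have "vx d j b + 2 = vx c i a + width \<and> a = 2 \<longleftrightarrow> vx d j b = vx (Suc c) i 0 \<and> a = 2"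
    by (auto simp: vx_def)
  moreover have "vx d j b = vx (Suc c) i 0 \<longleftrightarrow> d = Suc c \<and> j = i \<and> b = 0"
    using assms by (simp add: vx_inject)
  moreover have "vx c i 2 < vx (Suc c) i 0" using assms(1) by (simp add: vx_def width_def)
  moreover have "c = d \<Longrightarrow> i = j \<Longrightarrow> vx c i a < vx d j b \<longleftrightarrow> a < b" by (simp add: vx_def)
  ultimately show ?thesis unfolding edge_def dm * by auto
qed

lemma edge_vx_cx:
  assumes "i < paths" "a < 4"
  shows "edge (vx c i a) (cx d) \<longleftrightarrow> c = d \<and> a \<noteq> 3 \<and> checks c i a"
proof -
  note dm = vx_div_mod[OF assms(1,2), of c] cx_div_mod[of d]
  have *: "(4 * i + a) div 4 = i" "(4 * i + a) mod 4 = a" using assms by auto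
  \<comment> \<open>A link ends in the path vertex \<open>vx (Suc c) i 0\<close>, never in a
    checker.\<close>
  have "\<not> (cx d + 2 = vx c i a + width \<and> a = 2)"
    using vx_neq_cx[of i 0 "Suc c" d] assms by (auto simp: vx_def)
  moreover have "vx c i a < cx c" using assms by (simp add: vx_def cx_def)
  ultimately show ?thesis unfolding edge_def dm * by auto
qed

text \<open>A checker is the last vertex of its column, and its offset \<open>4 * paths\<close> is a
  multiple of 4, so no link starts there.\<close>

lemma not_edge_cx: "\<not> edge (cx c) v"
proof
  assume e: "edge (cx c) v"
  have "v div width = c \<Longrightarrow> v mod width \<le> 4 * paths \<Longrightarrow> v \<le> cx c"
    by (metis add_le_mono1 add.commute cx_def div_mult_mod_eq)
  with e show False unfolding edge_def cx_div_mod by auto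
qed

lemma i_mod_div:
  assumes "k < p" shows "(p * g + k) div p = g" "(p * g + k) mod p = k"
  using assms by auto

lemma literal_group:
  assumes "v < n" "k < p" shows "p * (v div \<beta>) + k < paths"
proof -
  have "v div \<beta> * \<beta> \<le> n - 1" using assms(1) by (metis Suc_diff_1 div_times_less_eq_dividend le_trans less_Suc_eq_le not_less_zero neq0_conv)
  then have "(v div \<beta> + 1) * \<beta> \<le> n + (\<beta> - 1)" using assms(1) \<beta>_pos by simp
  then have "v div \<beta> + 1 \<le> (n + (\<beta> - 1)) div \<beta>"
    using \<beta>_pos by (simp add: less_eq_div_iff_mult_less_eq)
  then have "p * (v div \<beta> + 1) \<le> paths" unfolding paths_def by (intro mult_le_mono) auto
  then show ?thesis using assms(2) by simp
qed

lemma clause_in: "0 < length cs \<Longrightarrow> clause_of c \<in> set cs"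
  unfolding clause_of_def by simp

lemma literal_less: "c \<in> set cs \<Longrightarrow> (v, b) \<in> set c \<Longrightarrow> v < n"
  using inst unfolding qsat_instances_def by auto

lemma clause_length: "c \<in> set cs \<Longrightarrow> length c \<le> q"
  using inst unfolding qsat_instances_def by auto

subsection \<open>From assignments to dominating sets\<close>

text \<open>Either the guess for the group of the true literal is wrong at some path, and that path
  dominates the checker, or it equals the code, and then every path of the group does; the proof
  takes path 0.\<close>

lemma checks_if_satisfied:
  assumes x: "\<And>g k. k < p \<Longrightarrow> x (p * g + k) = code g div 3 ^ k mod 3"
    and code: "\<And>g. code g < 3 ^ p"
    and l: "l < length (clause_of c)" "clause_of c ! l = (v, b)"
    and sat: "code (v div \<beta>) div 2 ^ (v mod \<beta>) mod 2 = of_bool b"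
  shows "\<exists>k<p. checks c (p * (v div \<beta>) + k) (x (p * (v div \<beta>) + k))"
proof (cases "\<exists>k<p. c div 3 ^ (p * l) mod 3 ^ p div 3 ^ k mod 3 \<noteq> code (v div \<beta>) div 3 ^ k mod 3")
  case True
  then obtain k where k: "k < p"
    "c div 3 ^ (p * l) mod 3 ^ p div 3 ^ k mod 3 \<noteq> code (v div \<beta>) div 3 ^ k mod 3" by blast
  then have "checks c (p * (v div \<beta>) + k) (x (p * (v div \<beta>) + k))"
    unfolding checks_def Let_def using l by (intro exI[of _ l]) (simp add: x i_mod_div)
  with k(1) show ?thesis by blast
next
  case False
  then have "c div 3 ^ (p * l) mod 3 ^ p = code (v div \<beta>)"
    by (intro number_eq_digits[OF _ code]) auto
  then have "checks c (p * (v div \<beta>) + 0) (x (p * (v div \<beta>) + 0))"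
    unfolding checks_def Let_def using l p_pos sat by (intro exI[of _ l]) simp
  with p_pos show ?thesis by blast
qed

text \<open>All columns use the same states: the values of a group are read as a binary number,
  whose base-3 digits are the states. Because of \<open>exp_le\<close>, \<open>p\<close> digits
  suffice.\<close>

lemma satisfiable_imp_dominating:
  assumes "satisfiable (n, cs)" shows "has_dominating_set graph"
proof -
  obtain \<alpha> where \<alpha>: "\<And>c. c \<in> set cs \<Longrightarrow> \<exists>(v, b)\<in>set c. \<alpha> v = b"
    using assms unfolding satisfiable_def by auto
  define code where "code g = digits 2 (\<lambda>k. of_bool (\<alpha> (\<beta> * g + k))) \<beta>" for g
  define x where "x i = code (i div p) div 3 ^ (i mod p) mod 3" for i
  have x3: "x i < 3" for i by (simp add: x_def)
  have code: "code g < 3 ^ p" for g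
  proof -
    have "code g < 2 ^ \<beta>" unfolding code_def by (rule digits_less) auto
    then show ?thesis using exp_le by linarith
  qed
  have bit: "code (v div \<beta>) div 2 ^ (v mod \<beta>) mod 2 = of_bool (\<alpha> v)" for v
  proof -
    have "code (v div \<beta>) div 2 ^ (v mod \<beta>) mod 2 ^ 1
        = digits 2 (\<lambda>k. of_bool (\<alpha> (\<beta> * (v div \<beta>) + (v mod \<beta> + k)))) 1"
      unfolding code_def using \<beta>_pos by (intro digits_div_mod) (auto simp: Suc_leI)
    then show ?thesis by (simp add: digits_def)
  qed
  define S where "S = (\<lambda>(c, i). vx c i (x i)) ` ({..<cols} \<times> {..<paths})"
  have S: "vx c i (x i) \<in> S" if "c < cols" "i < paths" for c i
    using that unfolding S_def by auto
  have x4: "x i < 4" for i using x3[of i] by simp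
  have "inj_on (\<lambda>(c, i). vx c i (x i)) ({..<cols} \<times> {..<paths})"
    by (rule inj_onI) (auto simp: vx_inject x4)
  then have card: "card S = paths * cols"
    unfolding S_def by (simp add: card_image mult.commute)
  have "S \<subseteq> {..<order}" unfolding S_def using x4 by (auto simp: vx_less)
  moreover have "u \<in> S \<or> (\<exists>w\<in>S. {w, u} \<in> edges graph)" if u: "u < order" for u
    using u
  proof (cases rule: vertex_cases)
    case (1 c i a)
    let ?w = "vx c i (x i)"
    have w: "?w \<in> S" "?w < order" using 1 x4 by (auto intro: S vx_less)
    \<comment> \<open>The choice in the same column dominates everything except the opposite end in
      an inner column; that end is dominated by the equal choice of the previous or next
      column.\<close>
    consider "a = x i" | "a = 0" "x i = 2" "c \<noteq> 0" "c + 1 \<noteq> cols"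
      | "a = 2" "x i = 0" "c \<noteq> 0" "c + 1 \<noteq> cols"
      | "a < x i" "a \<noteq> 0 \<or> x i \<noteq> 2 \<or> c = 0 \<or> c + 1 = cols"
      | "x i < a" "x i \<noteq> 0 \<or> a \<noteq> 2 \<or> c = 0 \<or> c + 1 = cols"
      by fastforce
    then show ?thesis
    proof cases
      case 1 then show ?thesis using w \<open>u = _\<close> by simp
    next
      case 2
      then obtain d where d: "c = Suc d" using not0_implies_Suc by blast
      have "vx d i (x i) \<in> S" "vx d i (x i) < order"
        using \<open>c < cols\<close> \<open>i < paths\<close> d x4 by (auto intro: S vx_less)
      moreover have "edge (vx d i (x i)) u"
        using 1 2 d by (simp add: edge_vx_vx)
      ultimately show ?thesis using in_edges u by blast
    next
      case 3
      have "vx (Suc c) i (x i) \<in> S" "vx (Suc c) i (x i) < order"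
        using \<open>c < cols\<close> \<open>i < paths\<close> 3 x4 S[of "Suc c" i] by (auto intro!: vx_less)
      moreover have "edge u (vx (Suc c) i (x i))"
        using 1 3 by (simp add: edge_vx_vx)
      ultimately show ?thesis using in_edges u by blast
    next
      case 4
      then have "edge u ?w" using 1 x4 by (simp add: edge_vx_vx)
      then show ?thesis using in_edges u w by blast
    next
      case 5
      then have "edge ?w u" using 1 x4 by (simp add: edge_vx_vx)
      then show ?thesis using in_edges u w by blast
    qed
  next
    case (2 c)
    then have "0 < length cs" unfolding cols_def by (auto intro: Nat.gr0I)
    note c = clause_in[OF this, of c]
    then obtain l v b where l: "l < length (clause_of c)" "clause_of c ! l = (v, b)" "\<alpha> v = b"
      using \<alpha>[OF c] by (auto simp: in_set_conv_nth)
    have vn: "v < n" using l literal_less[OF c] by (metis nth_mem)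
    obtain k where k: "k < p" "checks c (p * (v div \<beta>) + k) (x (p * (v div \<beta>) + k))"
      using checks_if_satisfied[where x = x and code = code, OF _ code l(1,2)] bit[of v] l(3)
      by (auto simp: x_def i_mod_div)
    let ?i = "p * (v div \<beta>) + k"
    have i: "?i < paths" using literal_group[OF vn k(1)] .
    have "edge (vx c ?i (x ?i)) u"
      using i x4[of ?i] x3[of ?i] k(2) 2 by (simp add: edge_vx_cx)
    moreover have "vx c ?i (x ?i) \<in> S" "vx c ?i (x ?i) < order"
      using 2 i x4 by (auto intro!: S vx_less)
    ultimately show ?thesis using in_edges u by blast
  qed
  ultimately have "dominating_set (verts graph) (edges graph) S"
    unfolding dominating_set_def verts_graph by auto
  with card show ?thesis unfolding has_dominating_set_def by (auto simp: graph_def)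
qed

subsection \<open>From dominating sets to assignments\<close>

text \<open>The budget leaves exactly one vertex for each path and column.\<close>

lemma tight_dominating_set:
  assumes "dominating_set (verts graph) (edges graph) S" "card S = paths * cols"
  obtains st where "\<And>c i. st c i < 4"
    "S = (\<lambda>(c, i). vx c i (st c i)) ` ({..<cols} \<times> {..<paths})"
proof -
  \<comment> \<open>All neighbours of the guard belong to its own path and column, so these closed
    neighbourhoods are disjoint and each of them uses up one vertex of the budget.\<close>
  have "\<exists>a<4. vx c i a \<in> S" if ci: "c < cols" "i < paths" for c i
  proof -
    have "vx c i 3 \<in> S \<or> (\<exists>u\<in>S. {u, vx c i 3} \<in> edges graph)"
      using assms(1) vx_less[OF ci, of 3] unfolding dominating_set_def verts_graph by auto
    moreover have "\<exists>a<4. u = vx c i a" if "{u, vx c i 3} \<in> edges graph" for u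
    proof (rule ccontr)
      assume no: "\<not> ?thesis"
      have u: "u < order" and e: "edge u (vx c i 3) \<or> edge (vx c i 3) u" using that in_edges by auto
      from u show False
      proof (cases rule: vertex_cases)
        case (1 d j a)
        then have "d = c" "j = i" using e ci by (auto simp: edge_vx_vx)
        then show False using no 1 by blast
      next
        case (2 d)
        then show False using e ci by (simp add: edge_vx_cx not_edge_cx)
      qed
    qed
    moreover have "(3::nat) < 4" by simp
    ultimately show ?thesis by blast
  qed
  then obtain st where st: "\<And>c i. c < cols \<Longrightarrow> i < paths \<Longrightarrow> st c i < 4 \<and> vx c i (st c i) \<in> S"
    by metis
  \<comment> \<open>The default 0 makes the bound 4 hold for all arguments.\<close>
  define st' where "st' c i = (if c < cols \<and> i < paths then st c i else 0)" for c i
  let ?f = "\<lambda>(c, i). vx c i (st' c i)" and ?D = "{..<cols} \<times> {..<paths}"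
  have st': "st' c i < 4" for c i using st by (simp add: st'_def)
  have "finite S" using assms(1) finite_subset unfolding dominating_set_def verts_graph by blast
  moreover have "?f ` ?D \<subseteq> S" using st by (auto simp: st'_def)
  moreover have "card (?f ` ?D) = card S"
  proof -
    have "inj_on ?f ?D" by (rule inj_onI) (auto simp: vx_inject st')
    then show ?thesis using assms(2) by (simp add: card_image mult.commute)
  qed
  ultimately have "?f ` ?D = S" by (rule card_subset_eq)
  with st' that show thesis by metis
qed

text \<open>Pigeonhole with the sum \<open>\<Phi>\<close> of all states as potential: it is at most
  \<open>2 * m\<close>, never rises, and falls within each block that contains a change, which
  cannot happen in all of the \<open>2 * m + 1\<close> blocks considered. Block 0 is left out
  because monotonicity starts at column 1 only.\<close>

lemma stable_block:
  fixes st :: "nat \<Rightarrow> nat \<Rightarrow> nat"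
  assumes le2: "\<And>c i. st c i \<le> 2" and K: "0 < K"
    and mono: "\<And>c i. 1 \<le> c \<Longrightarrow> c + 1 < (2 * m + 2) * K \<Longrightarrow> i < m \<Longrightarrow> st (Suc c) i \<le> st c i"
  obtains r where "1 \<le> r" "r < 2 * m + 2"
    "\<And>k i. k < K \<Longrightarrow> i < m \<Longrightarrow> st (r * K + k) i = st (r * K) i"
proof (rule ccontr)
  assume contr: "\<not> thesis"
  note found = that
  define \<Phi> where "\<Phi> c = (\<Sum>i<m. st c i)" for c
  have anti: "st (c + k) i \<le> st c i" if "1 \<le> c" "c + k < (2 * m + 2) * K" "i < m" for c k i
    using that
  proof (induction k)
    case (Suc k)
    then show ?case using mono[of "c + k" i] by (simp add: order_trans)
  qed simp
  have drop: "\<Phi> (Suc r * K - 1) < \<Phi> (r * K)" if r: "1 \<le> r" "r < 2 * m + 2" for r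
  proof -
    have lt: "r * K + k < (2 * m + 2) * K" if "k < K" for k
    proof -
      have "r * K + k < Suc r * K" using that by simp
      also have "\<dots> \<le> (2 * m + 2) * K" using r by (intro mult_right_mono) auto
      finally show ?thesis .
    qed
    have rK: "1 \<le> r * K" using r K by (simp add: Suc_leI)
    obtain k i where ki: "k < K" "i < m" "st (r * K + k) i \<noteq> st (r * K) i"
      using contr found[OF r] by blast
    \<comment> \<open>The last column of the block, reached from the changed column and from the
      start of the block.\<close>
    have e: "Suc r * K - 1 = (r * K + k) + (K - 1 - k)" "Suc r * K - 1 = r * K + (K - 1)"
      using ki(1) by auto
    have le: "st (Suc r * K - 1) j \<le> st (r * K) j" if "j < m" for j
      unfolding e(2) using anti[OF rK _ that, of "K - 1"] lt[of "K - 1"] K by simp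
    have "st (Suc r * K - 1) i \<le> st (r * K + k) i"
      unfolding e(1) using anti[of "r * K + k" "K - 1 - k" i] rK lt[of "K - 1"] K ki by simp
    also have "\<dots> < st (r * K) i"
      using anti[OF rK lt[OF ki(1)] ki(2)] ki(3) by simp
    finally show ?thesis unfolding \<Phi>_def using le ki(2) by (intro sum_strict_mono_ex1) auto
  qed
  have "\<Phi> (Suc r * K - 1) + r \<le> 2 * m" if "1 \<le> r" "r < 2 * m + 2" for r
    using that
  proof (induction r rule: dec_induct)
    case base
    have "\<Phi> (1 * K) \<le> (\<Sum>i<m. 2)" unfolding \<Phi>_def by (intro sum_mono le2)
    then have "\<Phi> (1 * K) \<le> 2 * m" by simp
    then show ?case using drop[of 1] by simp
  next
    case (step r)
    have rK: "1 < Suc r * K" using step K by (cases K) auto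
    have *: "Suc (Suc r * K - 1) = Suc r * K" using rK by simp
    have "Suc r * K < (2 * m + 2) * K" using step K by (intro mult_strict_right_mono) auto
    then have "st (Suc (Suc r * K - 1)) i \<le> st (Suc r * K - 1) i" if "i < m" for i
      using that rK by (intro mono) auto
    then have "\<Phi> (Suc r * K) \<le> \<Phi> (Suc r * K - 1)" unfolding \<Phi>_def * by (intro sum_mono) auto
    then show ?case using step drop[of "Suc r"] by simp
  qed
  from this[of "2 * m + 1"] show False by simp
qed

text \<open>In a round without changes the states spell out an assignment. If it falsified a clause,
  the column of that clause whose guess is precisely these states would have an undominated
  checker.\<close>

lemma dominating_imp_satisfiable:
  assumes "has_dominating_set graph" shows "satisfiable (n, cs)"
proof (cases "cs = []")
  case True
  then show ?thesis by (simp add: satisfiable_def)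
next
  case False
  obtain S where S: "dominating_set (verts graph) (edges graph) S" "card S = paths * cols"
    using assms unfolding has_dominating_set_def by (auto simp: graph_def)
  obtain st where st4: "\<And>c i. st c i < 4"
    and S_eq: "S = (\<lambda>(c, i). vx c i (st c i)) ` ({..<cols} \<times> {..<paths})"
    using tight_dominating_set[OF S] by metis
  define Q where "Q = (3::nat) ^ (p * q)"
  define m where "m = length cs"
  have m: "0 < m" using False by (simp add: m_def)
  have Q: "0 < Q" by (simp add: Q_def)
  have cols: "cols = (2 * paths + 3) * (m * Q)" by (simp add: cols_def m_def Q_def)
  have dom: "u \<in> S \<or> (\<exists>c i. c < cols \<and> i < paths \<and>
      (edge (vx c i (st c i)) u \<or> edge u (vx c i (st c i))))" if "u < order" for u
  proof -
    have "u \<in> S \<or> (\<exists>w\<in>S. edge w u \<or> edge u w)"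
      using S(1) that unfolding dominating_set_def verts_graph by (auto simp: in_edges)
    then show ?thesis unfolding S_eq by auto
  qed
  have vxS: "vx c i a \<in> S \<longleftrightarrow> a = st c i" if "c < cols" "i < paths" "a < 4" for c i a
    using that unfolding S_eq by (auto simp: vx_inject st4)
  have cxS: "cx c \<notin> S" for c
    unfolding S_eq using vx_neq_cx[OF _ st4] by (auto simp: image_iff dest: sym)
  \<comment> \<open>A chosen guard acts on its path like the middle vertex: it dominates its own
    column and forces nothing elsewhere. The change to 1 is harmless for the checkers, as a guard is
    adjacent to none.\<close>
  define x where "x c i = (if st c i = 3 then 1 else st c i)" for c i
  have x2: "x c i \<le> 2" for c i using st4[of c i] by (simp add: x_def)
  \<comment> \<open>Both columns must be inner ones: the first claim needs end 2 of column
    \<open>c\<close> not to be adjacent to end 0, the second needs the same in column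
    \<open>Suc c\<close>.\<close>
  have step: "x (Suc c) i \<le> x c i" if c: "1 \<le> c" "c + 2 < cols" and i: "i < paths" for c i
  proof -
    have "st (Suc c) i = 0" if "st c i = 0"
    proof -
      have "vx c i 2 < order" using c i by (intro vx_less) auto
      from dom[OF this] show ?thesis using c i that
        by (auto simp: vxS edge_vx_vx st4)
    qed
    moreover have "st c i = 2" if "st (Suc c) i = 2"
    proof -
      have "vx (Suc c) i 0 < order" using c i by (intro vx_less) auto
      from dom[OF this] show ?thesis using c i that
        by (auto simp: vxS edge_vx_vx st4)
    qed
    ultimately show ?thesis using st4[of c i] st4[of "Suc c" i]
      unfolding x_def by (cases "st c i = 0"; cases "st (Suc c) i = 2") auto
  qed
  obtain r where r: "1 \<le> r" "r < 2 * paths + 2"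
    and stable: "\<And>k i. k < m * Q \<Longrightarrow> i < paths \<Longrightarrow> x (r * (m * Q) + k) i = x (r * (m * Q)) i"
  proof (rule stable_block[where K = "m * Q" and m = paths and st = x])
    fix c i assume "1 \<le> c" "c + 1 < (2 * paths + 2) * (m * Q)" "i < paths"
    moreover have "(2 * paths + 2) * (m * Q) + 1 \<le> cols"
      unfolding cols add_mult_distrib using m Q by simp
    ultimately show "x (Suc c) i \<le> x c i" by (intro step) auto
  qed (use x2 m Q in auto)
  define y where "y i = x (r * (m * Q)) i" for i
  have y3: "y i < 3" for i using x2[of "r * (m * Q)" i] by (simp add: y_def)
  define code where "code g = digits 3 (\<lambda>k. y (p * g + k)) p" for g
  \<comment> \<open>Any combination of states is decoded, also one whose code is at least
    \<open>2 ^ \<beta>\<close>; its low \<open>\<beta>\<close> bits are read.\<close>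
  define \<alpha> where "\<alpha> v \<longleftrightarrow> code (v div \<beta>) div 2 ^ (v mod \<beta>) mod 2 = 1" for v
  have "\<exists>(v, b)\<in>set (cs ! j). \<alpha> v = b" if j: "j < m" for j
  proof (rule ccontr)
    assume unsat: "\<not> (\<exists>(v, b)\<in>set (cs ! j). \<alpha> v = b)"
    have C: "cs ! j \<in> set cs" using j by (simp add: m_def)
    \<comment> \<open>The right guess: its block \<open>l\<close> of \<open>p\<close> digits holds
      the states of the group of literal \<open>l\<close>; zeros pad clauses shorter than
      \<open>q\<close>.\<close>
    define d where "d t = (if t div p < length (cs ! j)
      then y (p * (fst (cs ! j ! (t div p)) div \<beta>) + t mod p) else 0)" for t
    have d3: "d t < 3" for t using y3 by (simp add: d_def)
    define z where "z = digits 3 d (p * q)"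
    have z: "z < Q" unfolding z_def Q_def by (rule digits_less) (rule d3)
    define c where "c = r * (m * Q) + (j * Q + z)"
    have "j * Q + z < Suc j * Q" using z by simp
    also have "\<dots> \<le> m * Q" using j by (intro mult_right_mono) auto
    finally have jz: "j * Q + z < m * Q" .
    have "c < Suc r * (m * Q)" unfolding c_def using jz by simp
    also have "\<dots> \<le> cols" unfolding cols using r by (intro mult_right_mono) auto
    finally have cc: "c < cols" .
    have "c = (r * m + j) * Q + z" by (simp add: c_def algebra_simps)
    then have "c div Q = r * m + j" using z by simp
    then have cl: "clause_of c = cs ! j" unfolding clause_of_def Q_def[symmetric] m_def[symmetric]
      using j by simp
    have zl: "c div 3 ^ (p * l) mod 3 ^ p = code (fst (cs ! j ! l) div \<beta>)"
      if l: "l < length (cs ! j)" for l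
    proof -
      have lq: "Suc l \<le> q" using l clause_length[OF C] by simp
      then obtain e where e: "q = Suc l + e" using le_Suc_ex by blast
      have Q': "Q = 3 ^ (p * l) * (3 ^ p * 3 ^ (p * e))"
        unfolding Q_def e by (simp add: power_add algebra_simps)
      have "c = z + 3 ^ (p * l) * (3 ^ p * (3 ^ (p * e) * (r * m + j)))"
        using \<open>c = (r * m + j) * Q + z\<close> by (simp add: Q' algebra_simps)
      then have "c div 3 ^ (p * l) mod 3 ^ p = z div 3 ^ (p * l) mod 3 ^ p" by simp
      also have "\<dots> = digits 3 (\<lambda>k. d (p * l + k)) p"
        unfolding z_def using lq mult_le_mono2[OF lq, of p] by (intro digits_div_mod d3) simp
      also have "\<dots> = code (fst (cs ! j ! l) div \<beta>)"
        unfolding digits_def code_def using l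
        by (intro sum.cong) (auto simp: d_def)
      finally show ?thesis .
    qed
    obtain c' i where ci: "c' < cols" "i < paths" "edge (vx c' i (st c' i)) (cx c)"
      using dom[OF cx_less[OF cc]] cxS not_edge_cx by blast
    then have "c' = c" "st c i \<noteq> 3" "checks c i (st c i)"
      using edge_vx_cx[OF ci(2) st4] by auto
    moreover have "x c i = y i" unfolding c_def y_def by (rule stable[OF jz ci(2)])
    ultimately have "checks c i (y i)" by (simp add: x_def)
    then obtain l where ll: "l < length (cs ! j)" "case cs ! j ! l of (v, b) \<Rightarrow>
        i div p = v div \<beta> \<and> (code (fst (cs ! j ! l) div \<beta>) div 3 ^ (i mod p) mod 3 \<noteq> y i \<or>
        code (fst (cs ! j ! l) div \<beta>) div 2 ^ (v mod \<beta>) mod 2 = of_bool b)"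
      unfolding checks_def cl Let_def using zl by auto
    obtain v b where vb: "cs ! j ! l = (v, b)" by fastforce
    note l = ll(1) vb
    have or: "code (v div \<beta>) div 3 ^ (i mod p) mod 3 \<noteq> y i \<or>
        code (v div \<beta>) div 2 ^ (v mod \<beta>) mod 2 = of_bool b" and iv: "i div p = v div \<beta>"
      using ll(2) unfolding vb by simp_all
    have "code (v div \<beta>) div 3 ^ (i mod p) mod 3 ^ 1 = digits 3 (\<lambda>k. y (p * (v div \<beta>) + (i mod p + k))) 1"
      unfolding code_def using p_pos y3 by (intro digits_div_mod) (auto simp: Suc_leI)
    also have "\<dots> = y i" unfolding iv[symmetric] by (simp add: digits_def)
    finally have "\<alpha> v = b" using or by (auto simp: \<alpha>_def)
    moreover have "(v, b) \<in> set (cs ! j)" using l by (metis nth_mem)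
    ultimately show False using unsat by auto
  qed
  then show ?thesis unfolding satisfiable_def m_def by (metis in_set_conv_nth snd_conv)
qed

theorem graph_correct: "has_dominating_set graph \<longleftrightarrow> satisfiable (n, cs)"
  using satisfiable_imp_dominating dominating_imp_satisfiable by blast

subsection \<open>Cutwidth\<close>

text \<open>A link from \<open>u\<close> ends in \<open>u + width - 2\<close>, so the sources of the
  links across the cut before \<open>k\<close> lie in a window shorter than \<open>width\<close>,
  which contains at most one per path.\<close>

lemma card_links:
  "card {u. u < k \<and> k + 2 \<le> u + width \<and> u mod width mod 4 = 2} \<le> paths"
proof -
  let ?A = "{u. u < k \<and> k + 2 \<le> u + width \<and> u mod width mod 4 = 2}"
  have "card ?A \<le> card {..<paths}"
  proof (rule card_inj_on_le[where f = "\<lambda>u. u mod width div 4"])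
    show "inj_on (\<lambda>u. u mod width div 4) ?A"
    proof (rule inj_onI)
      fix u v assume uv: "u \<in> ?A" "v \<in> ?A" "u mod width div 4 = v mod width div 4"
      then have "u mod width = v mod width"
        by (metis (mono_tags, lifting) div_mult_mod_eq mem_Collect_eq)
      moreover have "u < v + width" "v < u + width" using uv by auto
      ultimately show "u = v"
        by (metis (no_types, lifting) add.commute less_diff_conv2 linorder_le_cases
            mod_eq_dvd_iff_nat nat_dvd_not_less le_antisym zero_less_diff not_le)
    qed
    show "(\<lambda>u. u mod width div 4) ` ?A \<subseteq> {..<paths}"
    proof (rule image_subsetI)
      fix u assume "u \<in> ?A"
      then have *: "u mod width mod 4 = 2" by simp
      have "w div 4 < P" if "w < 4 * P + 1" "w mod 4 = 2" for w P :: nat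
        using div_mult_mod_eq[of w 4] that by linarith
      moreover have "u mod width < 4 * paths + 1"
        using mod_less_divisor[OF width_pos, of u] by (simp add: width_def)
      ultimately show "u mod width div 4 \<in> {..<paths}" using * by blast
    qed
  qed simp
  then show ?thesis by simp
qed

lemma finite_links: "finite {u. u < k \<and> k + 2 \<le> u + width \<and> u mod width mod 4 = 2}"
  by simp

text \<open>A path adjacent to the checker lies in the group of one of at most \<open>q\<close>
  literals, which leaves \<open>q * p\<close> paths with three states each.\<close>

lemma card_checks: "card {(i, a). a < 3 \<and> checks c i a} \<le> 3 * (p * q)"
  and finite_checks: "finite {(i, a). a < 3 \<and> checks c i a}"
  if "0 < length cs"
proof -
  let ?f = "\<lambda>(l, k, a). (p * (fst (clause_of c ! l) div \<beta>) + k, a)"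
    and ?D = "{..<q} \<times> {..<p} \<times> {..<3::nat}"
  have sub: "{(i, a). a < 3 \<and> checks c i a} \<subseteq> ?f ` ?D"
  proof safe
    fix i a :: nat assume a: "a < 3" and "checks c i a"
    then obtain l where l: "l < length (clause_of c)" "i div p = fst (clause_of c ! l) div \<beta>"
      unfolding checks_def Let_def by (metis (mono_tags, lifting) case_prod_beta)
    have "i = p * (i div p) + i mod p" by simp
    then have "(i, a) = ?f (l, i mod p, a)" using l(2) by simp
    moreover have "(l, i mod p, a) \<in> ?D"
      using l(1) a p_pos clause_length[OF clause_in[OF that], of c] by auto
    ultimately show "(i, a) \<in> ?f ` ?D" by (rule image_eqI)
  qed
  show "finite {(i, a). a < 3 \<and> checks c i a}" by (rule finite_subset[OF sub]) simp
  have "card {(i, a). a < 3 \<and> checks c i a} \<le> card ?D"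
    by (rule surj_card_le[OF _ sub]) simp
  then show "card {(i, a). a < 3 \<and> checks c i a} \<le> 3 * (p * q)"
    by (simp add: card_cartesian_product algebra_simps)
qed

text \<open>A cut meets at most one link per path, edges within the one block of four consecutive
  vertices that contains the cut position, and edges to the checker of the current column. The 16 is
  a crude count of the ordered pairs in that block.\<close>

lemma layout_cutwidth_graph: "layout_cutwidth graph \<le> paths + 3 * (p * q) + 16"
proof -
  have "card {e \<in> edges graph. \<exists>u v. e = {u, v} \<and> layout graph u \<le> k \<and> k < layout graph v}
      \<le> paths + 3 * (p * q) + 16" (is "card ?E \<le> _") if k: "k < order" for k
  proof -
    define c where "c = k div width"
    have c: "c < cols" using k unfolding c_def order_def by (simp add: less_mult_imp_div_less)
    then have m: "0 < length cs" unfolding cols_def by (auto intro: Nat.gr0I)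
    define B where "B = {c * width + 4 * (k mod width div 4) ..< c * width + 4 * (k mod width div 4) + 4}"
    let ?A1 = "(\<lambda>u. {u, u + width - 2}) ` {u. u < k \<and> k + 2 \<le> u + width \<and> u mod width mod 4 = 2}"
    let ?A2 = "(\<lambda>(u, v). {u, v}) ` (B \<times> B)"
    let ?A3 = "(\<lambda>(i, a). {vx c i a, cx c}) ` {(i, a). a < 3 \<and> checks c i a}"
    have "?E \<subseteq> ?A1 \<union> ?A2 \<union> ?A3"
    proof
      fix e assume "e \<in> ?E"
      then obtain u v where e: "e = {u, v}" and le: "layout graph u \<le> k" "k < layout graph v"
        and uv: "u < order" "v < order" "edge u v \<or> edge v u" using in_edges by auto
      \<comment> \<open>The layout is the numbering shifted by one, so the cut at \<open>k\<close>
        separates the vertices below \<open>k\<close> from the rest.\<close>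
      have lt: "u < k" "k \<le> v" using le uv(1,2) by (simp_all add: layout_def graph_def)
      have ed: "edge u v" using uv(3) lt edge_less by fastforce
      have div: "u div width \<le> c" "c \<le> v div width" unfolding c_def using lt
        by (auto intro: div_le_mono)
      have same: "u = c * width + u mod width" "v = c * width + v mod width" "k = c * width + k mod width"
        if "u div width = v div width"
        using that div by (metis c_def div_mult_mod_eq le_antisym)+
      consider (piece) "u div width = v div width" "u mod width div 4 = v mod width div 4"
        | (check) "u div width = v div width" "v mod width = 4 * paths" "u mod width mod 4 \<noteq> 3"
            "checks (u div width) (u mod width div 4) (u mod width mod 4)"
        | (link) "v + 2 = u + width" "u mod width mod 4 = 2"
        using ed unfolding edge_def by blast
      then show "e \<in> ?A1 \<union> ?A2 \<union> ?A3"
      proof cases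
        case piece
        have le: "u mod width \<le> k mod width" "k mod width \<le> v mod width"
          using same[OF piece(1)] lt by linarith+
        then have "u mod width div 4 = k mod width div 4" "v mod width div 4 = k mod width div 4"
          using piece(2) div_le_mono[OF le(1), of 4] div_le_mono[OF le(2), of 4] by linarith+
        moreover have "c * width + w \<in> B" if "w div 4 = k mod width div 4" for w
        proof -
          have "4 * (w div 4) \<le> w" "w < 4 * (w div 4) + 4" by presburger+
          then show ?thesis unfolding B_def that[symmetric] by auto
        qed
        ultimately have "c * width + u mod width \<in> B" "c * width + v mod width \<in> B"
          by blast+
        then have "u \<in> B" "v \<in> B" using same[OF piece(1)] by simp_all
        then show ?thesis unfolding e by auto
      next
        case check
        have uc: "u div width = c" using check(1) div by simp
        have "u = vx c (u mod width div 4) (u mod width mod 4)"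
          unfolding vx_def using same(1)[OF check(1)] by simp
        moreover have "v = cx c" unfolding cx_def using same(2)[OF check(1)] check(2) by simp
        moreover have "w mod 4 < 3" if "w mod 4 \<noteq> 3" for w :: nat using that by presburger
        note this[OF check(3)]
        ultimately have "e \<in> ?A3" unfolding e using check(4) uc
          by (intro image_eqI[of _ _ "(u mod width div 4, u mod width mod 4)"]) auto
        then show ?thesis by blast
      next
        case link
        then have "v = u + width - 2" "k + 2 \<le> u + width" using lt by auto
        then have "e \<in> ?A1" unfolding e using link lt by blast
        then show ?thesis by blast
      qed
    qed
    moreover have "finite (?A1 \<union> ?A2 \<union> ?A3)" using finite_checks[OF m] by (simp add: B_def)
    ultimately have "card ?E \<le> card (?A1 \<union> ?A2 \<union> ?A3)" by (intro card_mono)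
    also have "\<dots> \<le> card ?A1 + card ?A2 + card ?A3"
      by (meson add_mono card_Un_le le_trans order_refl)
    also have "card ?A1 \<le> paths" using card_image_le[OF finite_links] card_links le_trans by blast
    also have "card ?A2 \<le> 16"
    proof -
      have "card ?A2 \<le> card (B \<times> B)" by (rule card_image_le) (simp add: B_def)
      then show ?thesis by (simp add: B_def)
    qed
    also have "card ?A3 \<le> 3 * (p * q)"
      using card_image_le[OF finite_checks[OF m]] card_checks[OF m] le_trans by blast
    finally show ?thesis by simp
  qed
  then show ?thesis unfolding layout_cutwidth_def cutwidth_def verts_graph by auto
qed

end

section \<open>The reduction as a RAM program\<close>

subsection \<open>Symbolic execution of loop-free programs\<close>

fun sx :: "prog \<Rightarrow> state \<Rightarrow> state" where
  "sx Skip s = s"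
| "sx (Assign r e) s = ((fst s)(r := val e s), snd s)"
| "sx (Store a e) s = (fst s, (snd s)(val a s := val e s))"
| "sx (Seq p q) s = sx q (sx p s)"
| "sx (Cond e p q) s = (if val e s \<noteq> 0 then sx p s else sx q s)"
| "sx (While e p) s = s"

text \<open>Boundedness is required before every single step, hence also between two stores of a
  sequence. Excluding loops makes the dummy clause of \<open>sx\<close> for \<open>While\<close>
  harmless.\<close>

fun safe :: "nat \<Rightarrow> prog \<Rightarrow> state \<Rightarrow> bool" where
  "safe b Skip s = bnd b s"
| "safe b (Assign r e) s = bnd b s"
| "safe b (Store a e) s = bnd b s"
| "safe b (Seq p q) s = (safe b p s \<and> safe b q (sx p s))"
| "safe b (Cond e p q) s = (bnd b s \<and> (if val e s \<noteq> 0 then safe b p s else safe b q s))"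
| "safe b (While e p) s = False"

fun prog_weight :: "prog \<Rightarrow> nat" where
  "prog_weight Skip = 1"
| "prog_weight (Assign r e) = weight e"
| "prog_weight (Store a e) = weight a + weight e"
| "prog_weight (Seq p q) = prog_weight p + prog_weight q"
| "prog_weight (Cond e p q) = weight e + (prog_weight p + prog_weight q)"
| "prog_weight (While e p) = 0"

lemma run_sx: "safe b p s \<Longrightarrow> run b p s (prog_weight p) (sx p s)"
proof (induction p arbitrary: s)
  case (Cond e p q)
  show ?case
  proof (cases "val e s = 0")
    case True
    then have "run b (Cond e p q) s (weight e + prog_weight q) (sx q s)"
      using Cond by (intro run_Cond_False) auto
    then show ?thesis using True by (auto elim: run_mono)
  next
    case False
    then have "run b (Cond e p q) s (weight e + prog_weight p) (sx p s)"
      using Cond by (intro run_Cond_True) auto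
    then show ?thesis using False by (auto elim: run_mono)
  qed
next
  case (Seq p q)
  then show ?case using run_Seq[of b p s "prog_weight p" "sx p s" q "prog_weight q"] by simp
qed (simp_all add: run_Skip[unfolded One_nat_def] run_Assign run_Store)

lemma run_sxI: "safe b p s \<Longrightarrow> sx p s = s' \<Longrightarrow> run b p s (prog_weight p) s'"
  using run_sx by blast

lemma list_update_numeral: "(x # xs)[numeral k := v] = x # xs[pred_numeral k := v]"
  by (simp add: numeral_eq_Suc)

lemma bnd_cells:
  "bnd b (cells xs, \<mu>) \<longleftrightarrow> 0 < b \<and> (\<forall>x\<in>set xs. x < 2 ^ b) \<and> (\<forall>i. \<mu> i < 2 ^ b)"
proof -
  have "(\<forall>r. cells xs r < 2 ^ b) \<longleftrightarrow> (\<forall>x\<in>set xs. x < 2 ^ b)"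
    by (auto simp: cells_def all_set_conv_all_nth)
  then show ?thesis by (simp add: bnd_def)
qed

lemma lay_append2:
  "(lay \<mu> d ys)(d + length ys := u, Suc (d + length ys) := v) = lay \<mu> d (ys @ [u, v])"
  using lay_append[of \<mu> d ys u] lay_append[of \<mu> d "ys @ [u]" v] by simp

lemma lay_append_Suc:
  "(lay \<mu> d (ys @ [u]))(Suc (d + length ys) := v) = lay \<mu> d (ys @ [u, v])"
  using lay_append[of \<mu> d "ys @ [u]" v] by simp

lemmas sx_simps = cells_update cells_nth list_update_numeral bnd_cells

subsection \<open>The program\<close>

text \<open>Registers: 0 is a loop counter, 1 points to a clause of the input, 2 counts the clauses still to
  be skipped, 3 is the first free output cell, 4 to 9 hold the number of clauses, of paths and of
  columns, the width of a column, the number of vertices, and the length of the input, which is also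
  the address of the output.\<close>

abbreviation walk_body :: prog where
  "walk_body \<equiv> Seq (Assign 1 (Add (Reg 1) (Add (Mem (Reg 1)) (Const 1)))) (Assign 2 (Sub (Reg 2) (Const 1)))"

definition init1 :: "nat \<Rightarrow> nat \<Rightarrow> nat \<Rightarrow> prog" where
  "init1 p \<beta> q =
     Seq (Assign 4 (Mem (Const 1)))
    (Seq (Assign 5 (Mul (Const p) (Div (Add (Mem (Const 0)) (Const (\<beta> - 1))) (Const \<beta>))))
    (Seq (Assign 6 (Mul (Mul (Add (Mul (Const 2) (Reg 5)) (Const 3)) (Reg 4)) (Const (3 ^ (p * q)))))
    (Seq (Assign 7 (Add (Mul (Const 4) (Reg 5)) (Const 1)))
    (Seq (Assign 8 (Mul (Reg 6) (Reg 7)))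
    (Seq (Assign 1 (Const 2))
         (Assign 2 (Reg 4)))))))"

text \<open>The output starts right behind the input, which is still needed. The number of edges is
  not yet known; its cell holds 0 until \<open>post\<close> fills it in.\<close>

definition init2 :: prog where
  "init2 =
     Seq (Assign 9 (Reg 1))
    (Seq (Assign 1 (Const 0))
    (Seq (Store (Reg 9) (Reg 8))
    (Seq (Store (Add (Reg 9) (Const 1)) (Const 0))
    (Seq (Store (Add (Reg 9) (Const 2)) (Mul (Reg 5) (Reg 6)))
         (Assign 3 (Add (Reg 9) (Const 3)))))))"

definition literalE :: "nat \<Rightarrow> expr" where
  "literalE l = Mem (Add (Reg 1) (Const (Suc l)))"

definition stateE :: "nat \<Rightarrow> nat \<Rightarrow> expr \<Rightarrow> expr" where
  "stateE p l c = ModE (Div c (Const (3 ^ (p * l)))) (Const (3 ^ p))"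

text \<open>As \<open>expr\<close> has no exponentiation, the powers with exponents
  \<open>i mod p\<close> and \<open>v mod \<beta>\<close> are obtained by a case distinction over
  the possible exponents \<open>k\<close>, with \<open>3 ^ k\<close> and \<open>2 ^ k\<close> as
  constants.\<close>

definition checksE :: "nat \<Rightarrow> nat \<Rightarrow> nat \<Rightarrow> expr \<Rightarrow> expr \<Rightarrow> expr \<Rightarrow> expr" where
  "checksE p \<beta> q c i a = ExE q (\<lambda>l. Mul (LtE (Const l) (Mem (Reg 1)))
     (Mul (EqE (Div i (Const p)) (Div (Div (literalE l) (Const 2)) (Const \<beta>)))
       (Add (ExE p (\<lambda>k. Mul (EqE (ModE i (Const p)) (Const k))
              (NeE (ModE (Div (stateE p l c) (Const (3 ^ k))) (Const 3)) a)))
            (ExE \<beta> (\<lambda>k. Mul (EqE (ModE (Div (literalE l) (Const 2)) (Const \<beta>)) (Const k))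
              (EqE (ModE (Div (stateE p l c) (Const (2 ^ k))) (Const 2))
                   (ModE (literalE l) (Const 2))))))))"

abbreviation "UE \<equiv> Div (Reg 0) (Reg 8)"
abbreviation "VE \<equiv> ModE (Reg 0) (Reg 8)"

definition edgeE :: "nat \<Rightarrow> nat \<Rightarrow> nat \<Rightarrow> expr" where
  "edgeE p \<beta> q =
     (let cu = Div UE (Reg 7); cv = Div VE (Reg 7); ru = ModE UE (Reg 7); rv = ModE VE (Reg 7);
          four = Const 4; last = Mul four (Reg 5) in
      Mul (LtE UE VE)
        (Add (Mul (EqE cu cv)
               (Add (Mul (LtE rv last) (Mul (EqE (Div ru four) (Div rv four))
                      (Add (NeE (ModE ru four) (Const 0)) (Add (NeE (ModE rv four) (Const 2))
                        (Add (EqE cu (Const 0)) (EqE (Add cu (Const 1)) (Reg 6)))))))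
                    (Mul (EqE rv last) (Mul (NeE (ModE ru four) (Const 3))
                      (checksE p \<beta> q cu (Div ru four) (ModE ru four))))))
             (Mul (EqE (Add VE (Const 2)) (Add UE (Reg 7))) (EqE (ModE ru four) (Const 2)))))"

definition main1 :: "nat \<Rightarrow> nat \<Rightarrow> prog" where
  "main1 p q = Seq (Assign 1 (Const 2))
     (Assign 2 (ModE (Div (Div UE (Reg 7)) (Const (3 ^ (p * q)))) (Reg 4)))"

definition main2 :: "nat \<Rightarrow> nat \<Rightarrow> nat \<Rightarrow> prog" where
  "main2 p \<beta> q =
     Seq (Cond (edgeE p \<beta> q)
           (Seq (Store (Reg 3) UE)
           (Seq (Store (Add (Reg 3) (Const 1)) VE)
                (Assign 3 (Add (Reg 3) (Const 2)))))
           Skip)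
    (Seq (Assign 1 (Const 0))
         (Assign 0 (Add (Reg 0) (Const 1))))"

definition post :: prog where
  "post = Seq (Store (Add (Reg 9) (Const 1)) (Div (Sub (Reg 3) (Add (Reg 9) (Const 3))) (Const 2)))
              (Assign 0 (Const 0))"

definition layout_body :: prog where
  "layout_body = Seq (Store (Reg 3) (Add (Reg 0) (Const 1)))
    (Seq (Assign 3 (Add (Reg 3) (Const 1)))
         (Assign 0 (Add (Reg 0) (Const 1))))"

definition move_body :: prog where
  "move_body = Seq (Store (Reg 0) (Mem (Add (Reg 9) (Reg 0)))) (Assign 0 (Add (Reg 0) (Const 1)))"

definition erase_body :: prog where
  "erase_body = Seq (Store (Reg 0) (Const 0)) (Assign 0 (Add (Reg 0) (Const 1)))"

text \<open>Registers 1 and 2 are already 0 at this point; clearing the others turns the state into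
  an initial one.\<close>

definition reset :: prog where
  "reset = Seq (Assign 0 (Const 0)) (Seq (Assign 3 (Const 0)) (Seq (Assign 4 (Const 0))
    (Seq (Assign 5 (Const 0)) (Seq (Assign 6 (Const 0)) (Seq (Assign 7 (Const 0))
    (Seq (Assign 8 (Const 0)) (Assign 9 (Const 0))))))))"

abbreviation "walk_loop \<equiv> While (Reg 2) walk_body"
abbreviation "main_loop p \<beta> q \<equiv> While (Sub (Mul (Reg 8) (Reg 8)) (Reg 0))
  (Seq (main1 p q) (Seq walk_loop (main2 p \<beta> q)))"
abbreviation "layout_loop \<equiv> While (Sub (Reg 8) (Reg 0)) layout_body"
abbreviation "move_loop \<equiv> While (Sub (Sub (Reg 3) (Reg 9)) (Reg 0)) move_body"
abbreviation "erase_loop \<equiv> While (Sub (Reg 3) (Reg 0)) erase_body"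

definition reduction_prog :: "nat \<Rightarrow> nat \<Rightarrow> nat \<Rightarrow> prog" where
  "reduction_prog p \<beta> q =
     Seq (init1 p \<beta> q) (Seq walk_loop (Seq init2 (Seq (main_loop p \<beta> q) (Seq post
       (Seq layout_loop (Seq (Assign 0 (Const 0)) (Seq move_loop (Seq erase_loop reset))))))))"

section \<open>Correctness and step counts of the stages of the program\<close>

context reduction begin

definition clause_code :: "clause \<Rightarrow> nat list" where
  "clause_code c = length c # map (\<lambda>(v, b). 2 * v + of_bool b) c"

definition ptr :: "nat \<Rightarrow> nat" where
  "ptr j = 2 + length (concat (map clause_code (take j cs)))"

abbreviation "inp \<equiv> encode_cnf (n, cs)"
abbreviation "len \<equiv> length inp"
abbreviation "num \<equiv> length cs"

text \<open>Serves both as word length and as a bound for loop counts and for the output length. It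
  bounds the numbers themselves rather than their bit lengths, which is affordable since only
  polynomiality matters; overflow is then excluded by \<open>x < 2 ^ x\<close> alone.\<close>

definition bound :: nat where
  "bound = len + 3 + 2 * (order * order) + order + paths + cols + width + paths * cols + 2 * n + q"

abbreviation "outp \<equiv> encode_ds graph"

lemma inp_eq: "inp = n # num # concat (map clause_code cs)"
  by (simp add: encode_cnf_def clause_code_def[abs_def])

lemma ptr_0: "ptr 0 = 2"
  by (simp add: ptr_def)

lemma ptr_Suc: "j < num \<Longrightarrow> ptr (Suc j) = ptr j + Suc (length (cs ! j))"
  by (simp add: ptr_def take_Suc_conv_app_nth clause_code_def)

lemma ptr_num: "ptr num = len"
  by (simp add: ptr_def inp_eq)

lemma ptr_nth:
  assumes "j < num" "k \<le> length (cs ! j)"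
  shows "ptr j + k < len" "inp ! (ptr j + k) = clause_code (cs ! j) ! k"
proof -
  have "inp = [n, num] @ concat (map clause_code (take j cs)) @ clause_code (cs ! j) @
      concat (map clause_code (drop (Suc j) cs))"
    unfolding inp_eq using id_take_nth_drop[OF assms(1)]
    by (metis append_Cons append_Nil concat.simps(2) concat_append list.map(2) map_append)
  then have *: "inp = ([n, num] @ concat (map clause_code (take j cs))) @ clause_code (cs ! j) @
      concat (map clause_code (drop (Suc j) cs))" by simp
  have p: "ptr j = length ([n, num] @ concat (map clause_code (take j cs)))"
    by (simp add: ptr_def)
  have k: "k < length (clause_code (cs ! j))" using assms(2) by (simp add: clause_code_def)
  show "ptr j + k < len" unfolding * p using k by simp
  show "inp ! (ptr j + k) = clause_code (cs ! j) ! k"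
    unfolding * p nth_append_length_plus using k by (simp add: nth_append)
qed

lemma ptr_le: "j \<le> num \<Longrightarrow> ptr j \<le> len"
  using ptr_nth(1)[of j 0] ptr_num by (cases "j = num") auto

lemma num_le: "num \<le> len"
proof -
  have "num \<le> length (concat (map clause_code cs))"
    by (induction cs) (auto simp: clause_code_def)
  then show ?thesis by (simp add: inp_eq)
qed

lemma inp_bound:
  assumes "x \<in> set inp" shows "x \<le> bound"
proof -
  have "x \<le> 2 * n \<or> x \<le> len \<or> x \<le> q"
  proof -
    from assms consider "x = n" | "x = num" | c where "c \<in> set cs" "x = length c"
      | c v b where "c \<in> set cs" "(v, b) \<in> set c" "x = 2 * v + of_bool b"
      unfolding inp_eq by (auto simp: clause_code_def)
    then show ?thesis
    proof cases
      case 4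
      then have "v < n" using literal_less by blast
      then show ?thesis using 4 by (cases b) auto
    qed (use num_le clause_length in auto)
  qed
  then show ?thesis unfolding bound_def by linarith
qed

lemma less_exp_bound: "x \<le> bound \<Longrightarrow> x < 2 ^ bound"
  using less_exp[of bound] by linarith

lemma inp_cells_bound: "cells inp i < 2 ^ bound"
  using inp_bound by (auto simp: cells_def intro: less_exp_bound)

lemma consts_bound:
  "(2::nat) < 2 ^ bound" "num < 2 ^ bound" "paths < 2 ^ bound"
  "cols < 2 ^ bound" "width < 2 ^ bound" "order < 2 ^ bound" "len < 2 ^ bound"
  "paths * cols < 2 ^ bound" "Suc (Suc (Suc len)) < 2 ^ bound"
  by (rule less_exp_bound, use num_le in \<open>simp add: bound_def\<close>)+

lemma bound_pos: "0 < bound"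
  by (simp add: bound_def)

abbreviation regs :: "nat \<Rightarrow> nat \<Rightarrow> nat \<Rightarrow> nat \<Rightarrow> nat \<Rightarrow> nat \<Rightarrow> nat" where
  "regs x P k w d \<equiv> cells [x, P, k, w, num, paths, cols, width, order, d]"

definition walk_time :: nat where
  "walk_time = num * (1 + prog_weight walk_body) + 1"

text \<open>The memory only has to agree with the input on the input's own cells, because the loop
  also runs while the output grows behind it.\<close>

lemma run_walk:
  assumes j: "j \<le> num" and \<mu>: "\<And>i. i < len \<Longrightarrow> \<mu> i = inp ! i" "\<forall>i. \<mu> i < 2 ^ bound"
    and b: "x < 2 ^ bound" "o' < 2 ^ bound" "d < 2 ^ bound"
  shows "run bound walk_loop (regs x 2 j o' d, \<mu>) walk_time (regs x (ptr j) 0 o' d, \<mu>)"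
proof -
  define \<sigma> where "\<sigma> i = (regs x (ptr i) (j - i) o' d, \<mu>)" for i
  have le: "ptr i < 2 ^ bound" "j - i < 2 ^ bound" if "i \<le> j" for i
    by (rule less_exp_bound, use ptr_le[of i] num_le j that in \<open>simp add: bound_def\<close>)+
  have "run bound walk_loop (\<sigma> 0) (j * (weight (Reg 2) + prog_weight walk_body) + weight (Reg 2)) (\<sigma> j)"
  proof (rule run_While)
    fix i assume "i \<le> j"
    then show "bnd bound (\<sigma> i)"
      using bound_pos consts_bound le b \<mu>(2) by (simp add: \<sigma>_def bnd_cells)
  next
    fix i assume i: "i < j"
    have ij: "i < num" "i \<le> j" "Suc i \<le> j" using i j by auto
    have m: "\<mu> (ptr i) = length (cs ! i)"
      using ptr_nth[OF ij(1), of 0] \<mu>(1)[of "ptr i"] by (simp add: clause_code_def)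
    show "run bound walk_body (\<sigma> i) (prog_weight walk_body) (\<sigma> (Suc i))"
      by (rule run_sxI)
        (use bound_pos consts_bound le[OF ij(2)] le[OF ij(3)] b \<mu>(2) m ptr_Suc[OF ij(1)] in
          \<open>simp_all add: \<sigma>_def sx_simps\<close>)
  qed (simp_all add: \<sigma>_def sx_simps)
  moreover have "j * (weight (Reg 2) + prog_weight walk_body) + weight (Reg 2) \<le> walk_time"
    unfolding walk_time_def using j by (simp add: mult_le_mono)
  ultimately show ?thesis using run_mono by (simp add: \<sigma>_def ptr_0)
qed

lemma tr_checksE:
  assumes j: "j = val c s div 3 ^ (p * q) mod num" "0 < num"
    and s: "fst s 1 = ptr j" "\<And>i. i < len \<Longrightarrow> snd s i = inp ! i"
  shows "tr (checksE p \<beta> q c i a) s \<longleftrightarrow> checks (val c s) (val i s) (val a s)"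
proof -
  have jn: "j < num" using j by simp
  have cl: "clause_of (val c s) = cs ! j" using j by (simp add: clause_of_def)
  have lq: "length (cs ! j) \<le> q" using clause_length jn by simp
  have len: "val (Mem (Reg 1)) s = length (cs ! j)"
    using ptr_nth[OF jn, of 0] s by (simp add: clause_code_def)
  have lit: "val (literalE l) s = 2 * fst (cs ! j ! l) + of_bool (snd (cs ! j ! l))"
    if "l < length (cs ! j)" for l
    using that ptr_nth[OF jn, of "Suc l"] s
    by (simp add: literalE_def clause_code_def case_prod_beta)
  \<comment> \<open>These undo the case distinctions over exponents.\<close>
  have iff: "(\<exists>k<p. val i s mod p = k \<and> R k) \<longleftrightarrow> R (val i s mod p)"
    "(\<exists>k<\<beta>. v mod \<beta> = k \<and> R k) \<longleftrightarrow> R (v mod \<beta>)" for R and v :: nat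
    using p_pos \<beta>_pos by auto
  have "tr (checksE p \<beta> q c i a) s \<longleftrightarrow> (\<exists>l<q. l < length (cs ! j) \<and>
      val i s div p = val (literalE l) s div 2 div \<beta> \<and>
      (val c s div 3 ^ (p * l) mod 3 ^ p div 3 ^ (val i s mod p) mod 3 \<noteq> val a s \<or>
       val c s div 3 ^ (p * l) mod 3 ^ p div 2 ^ (val (literalE l) s div 2 mod \<beta>) mod 2
         = val (literalE l) s mod 2))"
    unfolding checksE_def tr_simps len stateE_def val.simps(1,7) iff ..
  also have "\<dots> \<longleftrightarrow> (\<exists>l<length (cs ! j).
      val i s div p = fst (cs ! j ! l) div \<beta> \<and>
      (val c s div 3 ^ (p * l) mod 3 ^ p div 3 ^ (val i s mod p) mod 3 \<noteq> val a s \<or>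
       val c s div 3 ^ (p * l) mod 3 ^ p div 2 ^ (fst (cs ! j ! l) mod \<beta>) mod 2
         = of_bool (snd (cs ! j ! l))))"
    (is "(\<exists>l. ?A l) \<longleftrightarrow> (\<exists>l. ?B l)")
  proof (rule ex_cong1)
    fix l
    have dm: "(2 * v + of_bool b) div 2 = v" "(2 * v + of_bool b) mod 2 = (of_bool b :: nat)"
      for v :: nat and b by (cases b; simp)+
    show "?A l \<longleftrightarrow> ?B l"
    proof (cases "l < length (cs ! j)")
      case True
      then have "l < q" using lq by linarith
      then show ?thesis by (simp only: True lit[OF True] dm simp_thms)
    qed simp
  qed
  also have "\<dots> \<longleftrightarrow> checks (val c s) (val i s) (val a s)"
    unfolding checks_def cl Let_def case_prod_beta ..
  finally show ?thesis .
qed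

lemma tr_edgeE:
  assumes x: "fst s 0 = x" "fst s 5 = paths" "fst s 6 = cols" "fst s 7 = width" "fst s 8 = order"
    and j: "j = x div order div width div 3 ^ (p * q) mod num" "0 < num"
    and s: "fst s 1 = ptr j" "\<And>i. i < len \<Longrightarrow> snd s i = inp ! i"
  shows "tr (edgeE p \<beta> q) s \<longleftrightarrow> edge (x div order) (x mod order)"
proof -
  have "j = val (Div UE (Reg 7)) s div 3 ^ (p * q) mod num" using x j(1) by simp
  then have ch: "tr (checksE p \<beta> q (Div UE (Reg 7)) i a) s \<longleftrightarrow>
      checks (val (Div UE (Reg 7)) s) (val i s) (val a s)" for i a
    using tr_checksE j(2) s by blast
  show ?thesis
    unfolding edgeE_def Let_def tr_Mul tr_Add ch unfolding tr_simps val.simps x edge_def by blast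
qed

lemma cells_inp: "i < len \<Longrightarrow> cells inp i = inp ! i"
  by (simp add: cells_def)

lemma lay_inp: "i < len \<Longrightarrow> lay (cells inp) len ys i = inp ! i"
  by (simp add: lay_def cells_def)

lemma lay_bound:
  assumes "\<forall>y\<in>set ys. y < 2 ^ bound" shows "\<forall>i. lay (cells inp) len ys i < 2 ^ bound"
  using assms inp_cells_bound by (auto intro: lay_less)

lemma run_init1:
  "run bound (init1 p \<beta> q) (start inp) (prog_weight (init1 p \<beta> q)) (regs 0 2 num 0 0, cells inp)"
proof -
  have "start inp = (cells [0,0,0,0,0,0,0,0,0,0], cells inp)"
    using cells_Nil_eq[of 10] by (simp add: start_eq numeral_eq_Suc)
  moreover have "cells inp 0 = n" "cells inp (Suc 0) = num"
    by (simp_all add: cells_def inp_eq)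
  moreover have "p * ((n + (\<beta> - Suc 0)) div \<beta>) = paths" "(2 * paths + 3) * num * 3 ^ (p * q) = cols"
    "Suc (4 * paths) = width" "cols * width = order"
    by (simp_all add: paths_def cols_def width_def order_def)
  ultimately show ?thesis
    by (intro run_sxI) (use bound_pos consts_bound inp_cells_bound in
      \<open>simp_all add: init1_def sx_simps\<close>)
qed

definition out :: "nat \<Rightarrow> nat list" where
  "out x = [order, 0, paths * cols] @ concat (map (\<lambda>(u, v). [u, v]) (pairs x))"

lemma run_init2:
  "run bound init2 (regs 0 len 0 0 0, cells inp) (prog_weight init2)
     (regs 0 0 0 (len + length (out 0)) len, lay (cells inp) len (out 0))"
proof -
  have "(cells inp)(len := a, Suc len := b, Suc (Suc len) := c) = lay (cells inp) len [a, b, c]" for a b c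
    using lay_append[of "cells inp" len "[]" a] lay_append2[of "cells inp" len "[a]" b c]
    by (simp add: lay_Nil)
  moreover have "\<forall>i. lay (cells inp) len [order, 0, paths * cols] i < 2 ^ bound"
    using consts_bound by (intro lay_bound) simp
  ultimately show ?thesis
    by (intro run_sxI) (use bound_pos consts_bound inp_cells_bound in
      \<open>simp_all add: init2_def sx_simps out_def pairs_def numeral_3_eq_3\<close>)
qed

lemma pairs_Suc:
  "pairs (Suc x) = pairs x @
    (if edge (x div order) (x mod order) then [(x div order, x mod order)] else [])"
  by (simp add: pairs_def)

lemma length_pairs: "length (pairs x) \<le> x"
  unfolding pairs_def using length_filter_le[of _ "[0..<x]"] by simp

lemma length_out: "length (out x) = 3 + 2 * length (pairs x)"
proof -
  have "length (concat (map (\<lambda>(u, v). [u, v]) ps)) = 2 * length ps" for ps :: "(nat \<times> nat) list"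
    by (induction ps) auto
  then show ?thesis by (simp add: out_def)
qed

lemma out_less:
  assumes "x \<le> order * order" "y \<in> set (out x)" shows "y < 2 ^ bound"
proof -
  have "a \<le> order \<and> b \<le> order" if "(a, b) \<in> set (pairs x)" for a b
  proof -
    have "set (pairs x) \<subseteq> set (pairs (order * order))"
      unfolding pairs_def using assms(1) by auto
    then show ?thesis using that set_pairs by auto
  qed
  then have "y \<le> order \<or> y = paths * cols"
    using assms(2) unfolding out_def by auto
  then show ?thesis by (intro less_exp_bound) (auto simp: bound_def)
qed

definition main_time :: nat where
  "main_time = order * order * (weight (Sub (Mul (Reg 8) (Reg 8)) (Reg 0)) +
     (prog_weight (main1 p q) + (walk_time + prog_weight (main2 p \<beta> q))))
     + weight (Sub (Mul (Reg 8) (Reg 8)) (Reg 0))"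

lemma run_main2:
  assumes x: "x < order * order" and j: "j = x div order div width div 3 ^ (p * q) mod num" "0 < num"
    and P: "ptr j < 2 ^ bound"
  shows "run bound (main2 p \<beta> q)
    (regs x (ptr j) 0 (len + length (out x)) len, lay (cells inp) len (out x))
    (prog_weight (main2 p \<beta> q))
    (regs (Suc x) 0 0 (len + length (out (Suc x))) len, lay (cells inp) len (out (Suc x)))"
proof -
  let ?s = "(regs x (ptr j) 0 (len + length (out x)) len, lay (cells inp) len (out x))"
  have "tr (edgeE p \<beta> q) ?s \<longleftrightarrow> edge (x div order) (x mod order)"
    using lay_inp by (intro tr_edgeE[OF _ _ _ _ _ j]) (simp_all add: sx_simps)
  then have edge: "val (edgeE p \<beta> q) ?s = 0 \<longleftrightarrow> \<not> edge (x div order) (x mod order)"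
    unfolding tr_def by blast
  have mem: "\<forall>i. lay (cells inp) len (out y) i < 2 ^ bound" if "y \<le> order * order" for y
    using out_less[OF that] by (intro lay_bound) blast
  note mem_x = mem[of x] mem[of "Suc x"]
  have less: "x < 2 ^ bound" "Suc x < 2 ^ bound" "len + length (out x) < 2 ^ bound"
    "Suc (Suc (len + length (out x))) < 2 ^ bound"
    by (rule less_exp_bound, use x length_pairs[of x] in \<open>simp add: bound_def length_out\<close>)+
  show ?thesis
  proof (cases "edge (x div order) (x mod order)")
    case True
    have out: "out (Suc x) = out x @ [x div order, x mod order]"
      using True by (simp add: out_def pairs_Suc)
    have u: "x div order < 2 ^ bound" "x mod order < 2 ^ bound"
      using out_less[of "Suc x"] x out by auto
    \<comment> \<open>The state between the two stores of one edge.\<close>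
    have mem1: "\<forall>i. lay (cells inp) len (out x @ [x div order]) i < 2 ^ bound"
      using out_less[of x] x u by (intro lay_bound) auto
    show ?thesis
      by (rule run_sxI)
        (use bound_pos consts_bound less P mem_x mem1 x True edge in
          \<open>simp_all add: main2_def sx_simps val_ModE lay_append lay_append_Suc out\<close>)
  next
    case False
    have out: "out (Suc x) = out x" using False by (simp add: out_def pairs_Suc)
    show ?thesis
      by (rule run_sxI)
        (use bound_pos consts_bound less P mem_x x False edge in
          \<open>simp_all add: main2_def sx_simps out\<close>)
  qed
qed

lemma run_main:
  "run bound (main_loop p \<beta> q)
     (regs 0 0 0 (len + length (out 0)) len, lay (cells inp) len (out 0)) main_time
     (regs (order * order) 0 0 (len + length (out (order * order))) len,
      lay (cells inp) len (out (order * order)))"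
proof -
  define \<sigma> where "\<sigma> x = (regs x 0 0 (len + length (out x)) len, lay (cells inp) len (out x))" for x
  have mem: "\<forall>i. lay (cells inp) len (out y) i < 2 ^ bound" if "y \<le> order * order" for y
    using out_less[OF that] by (intro lay_bound) blast
  have less: "x < 2 ^ bound" "len + length (out x) < 2 ^ bound" if "x \<le> order * order" for x
    by (rule less_exp_bound, use that length_pairs[of x] in \<open>simp add: bound_def length_out\<close>)+
  have "run bound (main_loop p \<beta> q) (\<sigma> 0) main_time (\<sigma> (order * order))"
    unfolding main_time_def
  proof (rule run_While)
    fix x assume "x \<le> order * order"
    then show "bnd bound (\<sigma> x)"
      using bound_pos consts_bound mem less by (simp add: \<sigma>_def bnd_cells)
  next
    fix x assume x: "x < order * order"
    \<comment> \<open>Without clauses there are no columns, hence no vertices and no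
      iterations.\<close>
    then have num: "0 < num" by (auto simp: order_def cols_def intro: Nat.gr0I)
    define j where "j = x div order div width div 3 ^ (p * q) mod num"
    have j: "j \<le> num" "j < num" unfolding j_def using num by simp_all
    have jb: "j < 2 ^ bound" "ptr j < 2 ^ bound"
      by (rule less_exp_bound, use j ptr_le[of j] num_le in \<open>simp add: bound_def\<close>)+
    have xle: "x \<le> order * order" using x by simp
    have "run bound (main1 p q) (\<sigma> x) (prog_weight (main1 p q))
        (regs x 2 j (len + length (out x)) len, lay (cells inp) len (out x))"
      by (rule run_sxI)
        (use bound_pos consts_bound less[OF xle] mem[OF xle] jb in
          \<open>simp_all add: main1_def \<sigma>_def sx_simps val_ModE j_def\<close>)
    moreover have "run bound walk_loop
        (regs x 2 j (len + length (out x)) len, lay (cells inp) len (out x)) walk_time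
        (regs x (ptr j) 0 (len + length (out x)) len, lay (cells inp) len (out x))"
      using j(1) lay_inp mem[OF xle] less[OF xle] consts_bound by (intro run_walk)
    moreover have "run bound (main2 p \<beta> q)
        (regs x (ptr j) 0 (len + length (out x)) len, lay (cells inp) len (out x))
        (prog_weight (main2 p \<beta> q)) (\<sigma> (Suc x))"
      unfolding \<sigma>_def by (rule run_main2[OF x j_def num jb(2)])
    ultimately show "run bound (Seq (main1 p q) (Seq walk_loop (main2 p \<beta> q))) (\<sigma> x)
        (prog_weight (main1 p q) + (walk_time + prog_weight (main2 p \<beta> q))) (\<sigma> (Suc x))"
      by (intro run_Seq)
  qed (simp_all add: \<sigma>_def sx_simps)
  then show ?thesis unfolding \<sigma>_def .
qed

definition out2 :: "nat \<Rightarrow> nat list" where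
  "out2 x = [order, length (pairs (order * order)), paths * cols] @
     concat (map (\<lambda>(u, v). [u, v]) (pairs (order * order))) @ map Suc [0..<x]"

lemma out2_order: "out2 order = outp"
  by (simp add: out2_def encode_ds_def graph_def)

lemma out2_0: "out2 0 = (out (order * order))[1 := length (pairs (order * order))]"
  by (simp add: out2_def out_def)

lemma out2_Suc: "out2 (Suc x) = out2 x @ [Suc x]"
  by (simp add: out2_def)

lemma length_out2: "length (out2 x) = 3 + 2 * length (pairs (order * order)) + x"
  using length_out[of "order * order"] by (simp add: out2_def out_def)

lemma out2_bound:
  assumes "x \<le> order" "y \<in> set (out2 x)" shows "y < 2 ^ bound"
proof -
  have "y \<in> set (out (order * order)) \<or> y = length (pairs (order * order)) \<or> y \<in> set (map Suc [0..<x])"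
    using assms(2) unfolding out2_def out_def by auto
  then show ?thesis
  proof (elim disjE)
    assume "y = length (pairs (order * order))"
    then show ?thesis using length_pairs[of "order * order"]
      by (intro less_exp_bound) (simp add: bound_def)
  next
    assume "y \<in> set (map Suc [0..<x])"
    then show ?thesis using assms(1) by (intro less_exp_bound) (auto simp: bound_def)
  qed (use out_less in blast)
qed

lemma out2_mem: "x \<le> order \<Longrightarrow> \<forall>i. lay (cells inp) len (out2 x) i < 2 ^ bound"
  using out2_bound by (intro lay_bound) blast

lemma out2_end: "x \<le> order \<Longrightarrow> len + length (out2 x) < 2 ^ bound"
  by (rule less_exp_bound, use length_pairs[of "order * order"] in \<open>simp add: bound_def length_out2\<close>)

lemma run_post:
  "run bound post
     (regs (order * order) 0 0 (len + length (out (order * order))) len,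
      lay (cells inp) len (out (order * order))) (prog_weight post)
     (regs 0 0 0 (len + length (out2 0)) len, lay (cells inp) len (out2 0))"
proof -
  let ?O = "out (order * order)"
  have mem: "\<forall>i. lay (cells inp) len ?O i < 2 ^ bound"
    using out_less[of "order * order"] by (intro lay_bound) blast
  have M: "(len + length ?O - (len + 3)) div 2 = length (pairs (order * order))"
    by (simp add: length_out)
  have upd: "(lay (cells inp) len ?O)(Suc len := length (pairs (order * order))) = lay (cells inp) len (out2 0)"
    using lay_update[of 1 ?O "cells inp" len] by (simp add: out2_0 length_out)
  have l: "length ?O = length (out2 0)" by (simp add: out2_0)
  have less: "order * order < 2 ^ bound" by (rule less_exp_bound) (simp add: bound_def)
  show ?thesis
    by (rule run_sxI)
      (use bound_pos consts_bound mem M upd less out2_mem[of 0] out2_end[of 0] in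
        \<open>simp_all add: post_def sx_simps l\<close>)
qed

definition layout_time :: nat where
  "layout_time = order * (weight (Sub (Reg 8) (Reg 0)) + prog_weight layout_body)
     + weight (Sub (Reg 8) (Reg 0))"

lemma run_layout:
  "run bound layout_loop (regs 0 0 0 (len + length (out2 0)) len, lay (cells inp) len (out2 0))
     layout_time (regs order 0 0 (len + length outp) len, lay (cells inp) len outp)"
proof -
  define \<sigma> where "\<sigma> x = (regs x 0 0 (len + length (out2 x)) len, lay (cells inp) len (out2 x))" for x
  have less: "x < 2 ^ bound" if "x \<le> order" for x
    by (rule less_exp_bound) (use that in \<open>simp add: bound_def\<close>)
  have "run bound layout_loop (\<sigma> 0) layout_time (\<sigma> order)"
    unfolding layout_time_def
  proof (rule run_While)
    fix x assume "x \<le> order"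
    then show "bnd bound (\<sigma> x)"
      using bound_pos consts_bound out2_mem out2_end less by (simp add: \<sigma>_def bnd_cells)
  next
    fix x assume x: "x < order"
    show "run bound layout_body (\<sigma> x) (prog_weight layout_body) (\<sigma> (Suc x))"
      by (rule run_sxI)
        (use bound_pos consts_bound less[of x] less[of "Suc x"] out2_mem[of x] out2_end[of x]
          out2_mem[of "Suc x"] out2_end[of "Suc x"] x in
          \<open>simp_all add: layout_body_def \<sigma>_def sx_simps lay_append out2_Suc\<close>)
  qed (simp_all add: \<sigma>_def sx_simps)
  then show ?thesis unfolding \<sigma>_def out2_order .
qed

lemma outp_mem: "\<forall>i. lay (cells inp) len outp i < 2 ^ bound"
  and outp_end: "len + length outp < 2 ^ bound"
  and outp_less: "y \<in> set outp \<Longrightarrow> y < 2 ^ bound"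
  using out2_mem[of order] out2_end[of order] out2_bound[of order] by (simp_all add: out2_order)

definition move_time :: nat where
  "move_time = length outp * (weight (Sub (Sub (Reg 3) (Reg 9)) (Reg 0)) + prog_weight move_body)
     + weight (Sub (Sub (Reg 3) (Reg 9)) (Reg 0))"

text \<open>Copying in ascending order is safe although the segments may overlap: cell
  \<open>len + x\<close> is read when only cells below \<open>x\<close> have been
  overwritten.\<close>

definition moved :: "nat \<Rightarrow> nat \<Rightarrow> nat" where
  "moved x = (\<lambda>i. if i < x then outp ! i else lay (cells inp) len outp i)"

lemma moved_bound: "x \<le> length outp \<Longrightarrow> \<forall>i. moved x i < 2 ^ bound"
  using outp_mem outp_less by (auto simp: moved_def)

lemma run_move:
  "run bound move_loop (regs 0 0 0 (len + length outp) len, lay (cells inp) len outp)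
     move_time (regs (length outp) 0 0 (len + length outp) len, moved (length outp))"
proof -
  define \<sigma> where "\<sigma> x = (regs x 0 0 (len + length outp) len, moved x)" for x
  have less: "x < 2 ^ bound" if "x \<le> length outp" for x
    using that outp_end by linarith
  have "run bound move_loop (\<sigma> 0) move_time (\<sigma> (length outp))"
    unfolding move_time_def
  proof (rule run_While)
    fix x assume "x \<le> length outp"
    then show "bnd bound (\<sigma> x)"
      using bound_pos consts_bound outp_end moved_bound less by (simp add: \<sigma>_def bnd_cells)
  next
    fix x assume x: "x < length outp"
    have "moved x (len + x) = outp ! x" using x by (simp add: moved_def lay_def)
    moreover have "(moved x)(x := outp ! x) = moved (Suc x)"
      by (auto simp: moved_def fun_eq_iff less_Suc_eq)
    ultimately show "run bound move_body (\<sigma> x) (prog_weight move_body) (\<sigma> (Suc x))"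
      by (intro run_sxI)
        (use bound_pos consts_bound less[of x] outp_end moved_bound[of x] moved_bound[of "Suc x"] x in
          \<open>simp_all add: move_body_def \<sigma>_def sx_simps\<close>)
  qed (simp_all add: \<sigma>_def sx_simps)
  then show ?thesis unfolding \<sigma>_def by (simp add: moved_def)
qed

definition erase_time :: nat where
  "erase_time = len * (weight (Sub (Reg 3) (Reg 0)) + prog_weight erase_body)
     + weight (Sub (Reg 3) (Reg 0))"

lemma run_erase:
  "run bound erase_loop (regs (length outp) 0 0 (len + length outp) len, moved (length outp))
     erase_time (regs (len + length outp) 0 0 (len + length outp) len, cells outp)"
proof -
  define \<mu> where "\<mu> x i = (if length outp \<le> i \<and> i < length outp + x then 0 else moved (length outp) i)" for x i
  define \<sigma> where "\<sigma> x = (regs (x + length outp) 0 0 (len + length outp) len, \<mu> x)" for x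
  have mem: "\<forall>i. \<mu> x i < 2 ^ bound" for x using moved_bound[of "length outp"] by (simp add: \<mu>_def)
  have less: "x + length outp < 2 ^ bound" if "x \<le> len" for x
    using that outp_end by linarith
  have "run bound erase_loop (\<sigma> 0) erase_time (\<sigma> len)"
    unfolding erase_time_def
  proof (rule run_While)
    fix x assume "x \<le> len"
    then show "bnd bound (\<sigma> x)"
      using bound_pos consts_bound outp_end mem less by (simp add: \<sigma>_def bnd_cells)
  next
    fix x assume x: "x < len"
    have "(\<mu> x)(x + length outp := 0) = \<mu> (Suc x)"
      by (auto simp: \<mu>_def fun_eq_iff)
    then show "run bound erase_body (\<sigma> x) (prog_weight erase_body) (\<sigma> (Suc x))"
      by (intro run_sxI)
        (use bound_pos consts_bound less[of x] outp_end mem[of x] mem[of "Suc x"] x in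
          \<open>simp_all add: erase_body_def \<sigma>_def sx_simps\<close>)
  qed (simp_all add: \<sigma>_def sx_simps)
  moreover have "\<mu> 0 = moved (length outp)" by (simp add: \<mu>_def fun_eq_iff)
  moreover have "\<mu> len = cells outp"
    by (auto simp: \<mu>_def fun_eq_iff moved_def lay_def cells_def)
  ultimately show ?thesis unfolding \<sigma>_def by simp
qed

lemma run_reset:
  "run bound reset (regs (len + length outp) 0 0 (len + length outp) len, cells outp)
     (prog_weight reset) (start outp)"
proof -
  have "start outp = (cells [0,0,0,0,0,0,0,0,0,0], cells outp)"
    using cells_Nil_eq[of 10] by (simp add: start_eq numeral_eq_Suc)
  moreover have "\<forall>i. cells outp i < 2 ^ bound" using outp_less by (auto simp: cells_def)
  ultimately show ?thesis
    by (intro run_sxI) (use bound_pos consts_bound outp_end in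
      \<open>simp_all add: reset_def sx_simps\<close>)
qed

definition total_time :: nat where
  "total_time = prog_weight (init1 p \<beta> q) + (walk_time + (prog_weight init2 + (main_time +
     (prog_weight post + (layout_time + (prog_weight (Assign 0 (Const 0)) + (move_time +
     (erase_time + prog_weight reset))))))))"

text \<open>The final state is exactly an initial state for the graph, so a solver can be appended
  by \<open>Seq\<close>.\<close>

theorem run_reduction: "run bound (reduction_prog p \<beta> q) (start inp) total_time (start outp)"
proof -
  have "run bound walk_loop (regs 0 2 num 0 0, cells inp) walk_time (regs 0 len 0 0 0, cells inp)"
    using run_walk[of num "cells inp" 0 0 0] cells_inp inp_cells_bound ptr_num by simp
  moreover have "run bound (Assign 0 (Const 0))
      (regs order 0 0 (len + length outp) len, lay (cells inp) len outp)
      (prog_weight (Assign 0 (Const 0)))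
      (regs 0 0 0 (len + length outp) len, lay (cells inp) len outp)"
    by (rule run_sxI) (use bound_pos consts_bound outp_mem outp_end in \<open>simp_all add: sx_simps\<close>)
  ultimately show ?thesis unfolding reduction_prog_def total_time_def
    using run_init1 run_init2 run_main run_post run_layout run_move run_erase run_reset
    by (intro run_Seq)
qed

end

section \<open>Running time\<close>

definition polyb :: "'i set \<Rightarrow> ('i \<Rightarrow> nat) \<Rightarrow> ('i \<Rightarrow> nat) \<Rightarrow> bool" where
  "polyb I g f \<longleftrightarrow> (\<exists>K c. \<forall>x\<in>I. f x \<le> K * g x ^ c)"

lemma polyb_le: "polyb I g f' \<Longrightarrow> (\<And>x. x \<in> I \<Longrightarrow> f x \<le> f' x) \<Longrightarrow> polyb I g f"
  unfolding polyb_def by (meson le_trans)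

lemma polyb_const: "polyb I g (\<lambda>_. k)"
  unfolding polyb_def by (intro exI[of _ k] exI[of _ 0]) simp

lemma polyb_self: "polyb I g g"
  unfolding polyb_def by (intro exI[of _ 1]) simp

lemma polyb_mult:
  assumes "polyb I g f" "polyb I g f'" shows "polyb I g (\<lambda>x. f x * f' x)"
proof -
  obtain K c K' c' where "\<And>x. x \<in> I \<Longrightarrow> f x \<le> K * g x ^ c" "\<And>x. x \<in> I \<Longrightarrow> f' x \<le> K' * g x ^ c'"
    using assms unfolding polyb_def by blast
  then have "f x * f' x \<le> (K * K') * g x ^ (c + c')" if "x \<in> I" for x
    using mult_le_mono[of "f x" "K * g x ^ c" "f' x" "K' * g x ^ c'"] that
    by (simp add: power_add mult_ac)
  then show ?thesis unfolding polyb_def by blast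
qed

lemma polyb_add:
  assumes "polyb I g f" "polyb I g f'" and pos: "\<And>x. x \<in> I \<Longrightarrow> 0 < g x"
  shows "polyb I g (\<lambda>x. f x + f' x)"
proof -
  obtain K c K' c' where K: "\<And>x. x \<in> I \<Longrightarrow> f x \<le> K * g x ^ c" "\<And>x. x \<in> I \<Longrightarrow> f' x \<le> K' * g x ^ c'"
    using assms(1,2) unfolding polyb_def by blast
  have "f x + f' x \<le> (K + K') * g x ^ (c + c')" if x: "x \<in> I" for x
  proof -
    have "g x ^ c \<le> g x ^ (c + c')" "g x ^ c' \<le> g x ^ (c + c')"
      using pos[OF x] by (auto intro: power_increasing)
    then have "K * g x ^ c \<le> K * g x ^ (c + c')" "K' * g x ^ c' \<le> K' * g x ^ (c + c')"
      by simp_all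
    then show ?thesis using K[OF x] unfolding distrib_right by linarith
  qed
  then show ?thesis unfolding polyb_def by blast
qed

context reduction begin

lemma length_outp: "length outp \<le> bound"
  using length_out2[of order] length_pairs[of "order * order"] unfolding out2_order bound_def by simp

lemma input_size_outp: "input_size outp \<le> bound * bound"
proof -
  have "input_size outp \<le> (\<Sum>y\<leftarrow>outp. bound)"
    unfolding input_size_def using outp_less bits_le bound_pos by (intro sum_list_mono) auto
  also have "\<dots> \<le> bound * bound" using length_outp by (simp add: sum_list_triv)
  finally show ?thesis .
qed

lemma len_le_input_size: "len \<le> input_size inp"
proof -
  have "length xs \<le> input_size xs" for xs
    unfolding input_size_def by (induction xs) (use bits_pos in \<open>auto simp: Suc_le_eq add_strict_increasing\<close>)
  then show ?thesis .
qed

lemma paths_le: "paths \<le> p * (n + \<beta>)"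
  unfolding paths_def using div_le_dividend[of "n + (\<beta> - 1)" \<beta>] by (intro mult_le_mono) linarith+

text \<open>All quantities of the instance are replaced by \<open>bound\<close>; the rest are
  constants of the program, so the closure rules of \<open>polyb\<close> apply by structure.\<close>

lemma total_time_bound: "total_time \<le> prog_weight (init1 p \<beta> q) + prog_weight init2 + prog_weight post
    + prog_weight (Assign 0 (Const 0)) + prog_weight reset
    + (bound * (1 + prog_weight walk_body) + 1)
    + (bound * (weight (Sub (Mul (Reg 8) (Reg 8)) (Reg 0)) + (prog_weight (main1 p q)
         + ((bound * (1 + prog_weight walk_body) + 1) + prog_weight (main2 p \<beta> q))))
       + weight (Sub (Mul (Reg 8) (Reg 8)) (Reg 0)))
    + (bound * (weight (Sub (Reg 8) (Reg 0)) + prog_weight layout_body) + weight (Sub (Reg 8) (Reg 0)))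
    + (bound * (weight (Sub (Sub (Reg 3) (Reg 9)) (Reg 0)) + prog_weight move_body)
       + weight (Sub (Sub (Reg 3) (Reg 9)) (Reg 0)))
    + (bound * (weight (Sub (Reg 3) (Reg 0)) + prog_weight erase_body) + weight (Sub (Reg 3) (Reg 0)))"
proof -
  have le: "num \<le> bound" "order * order \<le> bound" "order \<le> bound" "len \<le> bound"
    using num_le by (auto simp: bound_def)
  have "walk_time \<le> bound * (1 + prog_weight walk_body) + 1"
    unfolding walk_time_def using le by (intro add_mono mult_le_mono) auto
  moreover from this have "main_time \<le> bound * (weight (Sub (Mul (Reg 8) (Reg 8)) (Reg 0)) +
      (prog_weight (main1 p q) + ((bound * (1 + prog_weight walk_body) + 1) + prog_weight (main2 p \<beta> q))))
       + weight (Sub (Mul (Reg 8) (Reg 8)) (Reg 0))"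
    unfolding main_time_def using le by (intro add_mono mult_le_mono order_refl)
  moreover have "layout_time \<le> bound * (weight (Sub (Reg 8) (Reg 0)) + prog_weight layout_body)
      + weight (Sub (Reg 8) (Reg 0))"
    unfolding layout_time_def using le by (intro add_mono mult_le_mono order_refl)
  moreover have "move_time \<le> bound * (weight (Sub (Sub (Reg 3) (Reg 9)) (Reg 0)) + prog_weight move_body)
       + weight (Sub (Sub (Reg 3) (Reg 9)) (Reg 0))"
    unfolding move_time_def using length_outp by (intro add_mono mult_le_mono order_refl)
  moreover have "erase_time \<le> bound * (weight (Sub (Reg 3) (Reg 0)) + prog_weight erase_body)
      + weight (Sub (Reg 3) (Reg 0))"
    unfolding erase_time_def using le by (intro add_mono mult_le_mono order_refl)
  ultimately show ?thesis unfolding total_time_def by linarith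
qed

lemma bound_le: "bound \<le> (let S = input_size inp; N = p * (n + \<beta>);
     L = (2 * N + 3) * S * 3 ^ (p * q); W = 4 * N + 1 in
     S + 3 + 2 * ((L * W) * (L * W)) + L * W + N + L + W + N * L + 2 * n + q)"
proof -
  have S: "num \<le> input_size inp" "len \<le> input_size inp" using num_le len_le_input_size by linarith+
  have W: "width \<le> 4 * (p * (n + \<beta>)) + 1" unfolding width_def using paths_le by simp
  have L: "cols \<le> (2 * (p * (n + \<beta>)) + 3) * input_size inp * 3 ^ (p * q)"
    unfolding cols_def using paths_le S by (intro mult_le_mono add_mono) auto
  show ?thesis unfolding bound_def order_def Let_def
    using paths_le W L S by (intro add_mono mult_le_mono) auto
qed

end

section \<open>Choice of parameters and transfer of a fast algorithm to satisfiability\<close>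

text \<open>Bernoulli's inequality for \<open>a\<close>, the root of \<open>\<rho>\<close> of order
  \<open>Suc c\<close>, bounds \<open>n + 1\<close> by a multiple of \<open>a ^ n\<close>; then the
  power \<open>Suc c\<close> is taken. The successor keeps the order of the root positive.\<close>

lemma exp_dominates_poly:
  fixes \<rho> :: real assumes "1 < \<rho>"
  obtains K where "0 < K" "\<And>n. real (n + 1) ^ c \<le> K * \<rho> ^ n"
proof -
  define a where "a = root (Suc c) \<rho>"
  have a: "1 < a" "a ^ Suc c = \<rho>" unfolding a_def using assms
    by (simp_all del: power_Suc add: real_root_gt_1_iff real_root_pow_pos2)
  define k where "k = 1 + 1 / (a - 1)"
  have k: "1 \<le> k" using a(1) by (simp add: k_def)
  have "real (n + 1) ^ c \<le> k ^ Suc c * \<rho> ^ n" for n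
  proof -
    have "1 + real n * (a - 1) \<le> (1 + (a - 1)) ^ n"
      using a(1) by (intro Bernoulli_inequality) simp
    then have b: "1 + real n * (a - 1) \<le> a ^ n" by simp
    have "1 \<le> a ^ n" using a(1) by (simp add: one_le_power)
    moreover have "real n \<le> a ^ n / (a - 1)" using b a(1) by (simp add: field_simps)
    ultimately have "real (n + 1) \<le> k * a ^ n" unfolding k_def by (simp add: distrib_right)
    then have "real (n + 1) ^ Suc c \<le> (k * a ^ n) ^ Suc c" by (intro power_mono) auto
    also have "\<dots> = k ^ Suc c * \<rho> ^ n"
      unfolding a(2)[symmetric] power_mult_distrib by (simp only: power_mult[symmetric] mult.commute)
    finally have "real (n + 1) ^ Suc c \<le> k ^ Suc c * \<rho> ^ n" .
    moreover have "real (n + 1) ^ c \<le> real (n + 1) ^ Suc c" by (intro power_increasing) auto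
    ultimately show ?thesis by linarith
  qed
  moreover have "0 < k ^ Suc c" using k by simp
  ultimately show thesis using that by blast
qed

lemma cost_pos: "0 < cost e s"
  by (induction e) (simp_all add: bits_pos)

lemma exec_pos: "exec p s t s' \<Longrightarrow> 0 < t"
  by (induction rule: exec.induct) (simp_all add: cost_pos)

lemma reductionI:
  assumes "0 < p" "0 < \<beta>" "2 ^ \<beta> \<le> (3::nat) ^ p" "x \<in> qsat_instances q"
  shows "reduction p \<beta> q (fst x) (snd x)"
  using assms by unfold_locales auto

lemma reduction_poly:
  assumes "0 < p" "0 < \<beta>" "2 ^ \<beta> \<le> (3::nat) ^ p"
  obtains K c where "\<And>x. x \<in> qsat_instances q \<Longrightarrow>
      reduction.total_time p \<beta> q (fst x) (snd x) * reduction.bound p \<beta> q (fst x) (snd x)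
        \<le> K * (fst x + input_size (encode_cnf x)) ^ c"
    "\<And>x. x \<in> qsat_instances q \<Longrightarrow>
      reduction.bound p \<beta> q (fst x) (snd x) * reduction.bound p \<beta> q (fst x) (snd x)
        \<le> K * (fst x + input_size (encode_cnf x)) ^ c"
proof -
  let ?g = "\<lambda>x. fst x + input_size (encode_cnf x)" and ?I = "qsat_instances q"
  have pos: "0 < ?g x" for x
    using bits_pos by (cases x) (simp add: encode_cnf_def input_size_def)
  note poly = polyb_const polyb_add[OF _ _ pos] polyb_mult
  have S: "polyb ?I ?g (\<lambda>x. input_size (encode_cnf x))" "polyb ?I ?g fst"
    by (rule polyb_le[OF polyb_self], simp)+
  have b: "polyb ?I ?g (\<lambda>x. reduction.bound p \<beta> q (fst x) (snd x))"
    by (rule polyb_le[OF _ reduction.bound_le[OF reductionI[OF assms], unfolded Let_def prod.collapse]])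
      (intro poly S)
  have t: "polyb ?I ?g (\<lambda>x. reduction.total_time p \<beta> q (fst x) (snd x))"
    by (rule polyb_le[OF _ reduction.total_time_bound[OF reductionI[OF assms]]])
      (intro poly b)
  \<comment> \<open>Bounding the sum yields common constants \<open>K\<close> and \<open>c\<close>
    for both products.\<close>
  have "polyb ?I ?g (\<lambda>x. reduction.total_time p \<beta> q (fst x) (snd x) * reduction.bound p \<beta> q (fst x) (snd x)
      + reduction.bound p \<beta> q (fst x) (snd x) * reduction.bound p \<beta> q (fst x) (snd x))"
    by (intro poly t b)
  then obtain K c where "\<And>x. x \<in> ?I \<Longrightarrow>
      reduction.total_time p \<beta> q (fst x) (snd x) * reduction.bound p \<beta> q (fst x) (snd x)
      + reduction.bound p \<beta> q (fst x) (snd x) * reduction.bound p \<beta> q (fst x) (snd x) \<le> K * ?g x ^ c"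
    unfolding polyb_def by blast
  then show thesis using that[of K c] by (meson add_leD1 add_leD2)
qed

text \<open>Rounding \<open>3 ^ p\<close> down to a power of 2 loses less than a factor 2, so
  \<open>p\<close> is taken so large that \<open>\<kappa> ^ p\<close> is below half of
  \<open>3 ^ p\<close>. The resulting \<open>\<mu>\<close> is the base per variable:
  \<open>\<beta>\<close> variables cost \<open>p\<close> paths.\<close>

lemma grouping_parameters:
  fixes \<kappa> :: real assumes "2 \<le> \<kappa>" "\<kappa> < 3"
  obtains p \<beta> \<mu> where "0 < p" "0 < \<beta>" "2 ^ \<beta> \<le> (3::nat) ^ p" "1 \<le> \<mu>" "\<mu> < 2" "\<mu> ^ \<beta> = \<kappa> ^ p"
proof -
  obtain p where p: "(\<kappa> / 3) ^ p < 1 / 2"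
    using real_arch_pow_inv[of "1 / 2" "\<kappa> / 3"] assms by auto
  have p0: "0 < p" using p by (cases p) auto
  define \<beta> where "\<beta> = floor_log (3 ^ p)"
  have 1: "2 ^ \<beta> \<le> (3::nat) ^ p" unfolding \<beta>_def by (rule floor_log_exp2_le) simp
  have 2: "(3::nat) ^ p < 2 * 2 ^ \<beta>" unfolding \<beta>_def using floor_log_exp2_gt[of "3 ^ p"] by simp
  have "(3::nat) ^ 1 \<le> 3 ^ p" using p0 by (intro power_increasing) auto
  then have \<beta>0: "0 < \<beta>" using 2 by (cases \<beta>) auto
  have "\<kappa> ^ p < 3 ^ p / 2" using p by (simp add: power_divide field_simps)
  moreover have "real (3 ^ p) < real (2 * 2 ^ \<beta>)" using 2 by (simp only: of_nat_less_iff)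
  ultimately have less: "\<kappa> ^ p < 2 ^ \<beta>" by simp
  define \<mu> where "\<mu> = root \<beta> (\<kappa> ^ p)"
  have \<mu>: "\<mu> ^ \<beta> = \<kappa> ^ p" unfolding \<mu>_def using \<beta>0 assms by (simp add: real_root_pow_pos2)
  have "1 \<le> \<mu>" unfolding \<mu>_def using \<beta>0 assms by (simp add: real_root_ge_1_iff one_le_power)
  moreover have "\<mu> < 2" using less unfolding \<mu>[symmetric] by (rule power_less_imp_less_base) simp
  ultimately show thesis using that p0 \<beta>0 1 \<mu> by blast
qed

text \<open>Handles large \<epsilon>. Even powers of a negative base may be large, so the witness is
  a single edge, of cutwidth 1: its time bound would not be positive, but every run takes positive
  time.\<close>

lemma base_pos:
  assumes "solvable_Ostar ds_instances encode_ds has_dominating_set layout_cutwidth (\<lambda>k. a ^ k)"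
  shows "0 < a"
proof (rule ccontr)
  assume a: "\<not> 0 < a"
  let ?x = "(2, [(0, 1)], [1, 2], 1) :: ds_instance"
  have V: "verts ?x = {0, 1}" by (auto simp: verts_def)
  have E: "edges ?x = {{0, 1}}" by (simp add: edges_def)
  have l: "layout ?x 0 = 1" "layout ?x 1 = 2" by (simp_all add: layout_def)
  have "?x \<in> ds_instances"
  proof -
    have "simple_graph (verts ?x) (edges ?x)"
      unfolding V E simple_graph_def by auto
    moreover have "linear_layout (verts ?x) (layout ?x)"
    proof -
      have "{1..card (verts ?x)} = {1, 2}" unfolding V by auto
      then show ?thesis unfolding linear_layout_def bij_betw_def V using l by simp
    qed
    ultimately show ?thesis unfolding ds_instances_def by simp
  qed
  moreover have "layout_cutwidth ?x = 1"
  proof -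
    have "\<exists>u v. {0, 1} = {u, v} \<and> layout ?x u \<le> 1 \<and> 1 < layout ?x v"
      using l by (intro exI[of _ 0] exI[of _ 1]) simp
    then have "{e \<in> edges ?x. \<exists>u v. e = {u, v} \<and> layout ?x u \<le> 1 \<and> 1 < layout ?x v} = {{0, 1}}"
      unfolding E by auto
    moreover have "{1..<card (verts ?x)} = {1}" unfolding V by auto
    ultimately show ?thesis unfolding layout_cutwidth_def cutwidth_def by simp
  qed
  moreover obtain p C c where "0 < C" "decides_within p ds_instances encode_ds has_dominating_set
      (\<lambda>x. C * (a ^ layout_cutwidth x * real (input_size (encode_ds x)) ^ c))"
    using assms unfolding solvable_Ostar_def by blast
  ultimately obtain t s where "exec p (start (encode_ds ?x)) t s" and
    t: "real t \<le> C * (a * real (input_size (encode_ds ?x)) ^ c)" and C: "0 < C"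
    unfolding decides_within_def by (metis power_one_right)
  then have "0 < t" using exec_pos by blast
  moreover have "C * (a * real (input_size (encode_ds ?x)) ^ c) \<le> 0"
    using a C by (simp add: mult_le_0_iff)
  ultimately show False using t by simp
qed

text \<open>Up to constant factors the solver costs \<open>\<mu> ^ n\<close> times a polynomial in
  \<open>n\<close> and the input size; the gap between \<open>\<mu>\<close> and \<open>\<nu>\<close>
  absorbs the part depending on \<open>n\<close>.\<close>

lemma qsat_solvable:
  fixes \<kappa> \<mu> \<nu> :: real
  assumes dec: "decides_within P ds_instances encode_ds has_dominating_set
      (\<lambda>x. C * (\<kappa> ^ layout_cutwidth x * real (input_size (encode_ds x)) ^ c))"
    and C: "0 < C" and \<kappa>: "1 \<le> \<kappa>"
    and par: "0 < p" "0 < \<beta>" "2 ^ \<beta> \<le> (3::nat) ^ p" and \<mu>: "1 \<le> \<mu>" "\<mu> ^ \<beta> = \<kappa> ^ p" and \<nu>: "\<mu> < \<nu>"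
  shows "solvable_Ostar (qsat_instances q) encode_cnf satisfiable num_vars (\<lambda>n. \<nu> ^ n)"
proof -
  obtain K d where K: "\<And>x. x \<in> qsat_instances q \<Longrightarrow>
      reduction.total_time p \<beta> q (fst x) (snd x) * reduction.bound p \<beta> q (fst x) (snd x)
        \<le> K * (fst x + input_size (encode_cnf x)) ^ d"
    "\<And>x. x \<in> qsat_instances q \<Longrightarrow>
      reduction.bound p \<beta> q (fst x) (snd x) * reduction.bound p \<beta> q (fst x) (snd x)
        \<le> K * (fst x + input_size (encode_cnf x)) ^ d"
    using reduction_poly[OF par] by metis
  \<comment> \<open>Covers \<open>d\<close> for the reduction itself and \<open>d * c\<close> for
    the solver's polynomial in the size of the graph instance.\<close>
  define e where "e = d + d * c"
  obtain G where G: "0 < G" "\<And>n. real (n + 1) ^ e \<le> G * (\<nu> / \<mu>) ^ n"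
    using exp_dominates_poly[of "\<nu> / \<mu>" e] \<mu> \<nu> by auto
  define A where "A = real K + C * \<kappa> ^ (3 * (p * q) + 16) * \<mu> ^ \<beta> * real K ^ c"
  have A: "0 \<le> A" unfolding A_def using C \<kappa> \<mu> by (intro add_nonneg_nonneg mult_nonneg_nonneg) auto
  have "decides_within (Seq (reduction_prog p \<beta> q) P) (qsat_instances q) encode_cnf satisfiable
      (\<lambda>x. (A * G + 1) * (\<nu> ^ num_vars x * real (input_size (encode_cnf x)) ^ e))"
    unfolding decides_within_def
  proof
    fix x assume x: "x \<in> qsat_instances q"
    define n where "n = fst x"
    define S where "S = input_size (encode_cnf x)"
    interpret reduction p \<beta> q n "snd x" using reductionI[OF par x] unfolding n_def .
    have xx: "(n, snd x) = x" by (simp add: n_def)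
    obtain t1 where t1: "exec (reduction_prog p \<beta> q) (start (encode_cnf x)) t1 (start outp)"
      "t1 \<le> total_time * bound"
      using run_reduction unfolding run_def xx by blast
    obtain t2 s where t2: "exec P (start outp) t2 s" "fst s 0 \<noteq> 0 \<longleftrightarrow> has_dominating_set graph"
      "real t2 \<le> C * (\<kappa> ^ layout_cutwidth graph * real (input_size outp) ^ c)"
      using dec graph_in_ds_instances unfolding decides_within_def by blast
    have S1: "1 \<le> S"
      unfolding S_def using bits_pos by (cases x) (simp add: encode_cnf_def input_size_def Suc_leI)
    define X where "X = real (n + S)"
    have X1: "1 \<le> X" using S1 by (simp add: X_def)
    \<comment> \<open>Separates \<open>n\<close> from the input size, so that only the former is
      traded for an exponential.\<close>
    have XX: "X \<le> real (n + 1) * real S"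
    proof -
      have "n + S \<le> (n + 1) * S" using S1 by (cases S) auto
      then show ?thesis unfolding X_def by (metis of_nat_le_iff of_nat_mult)
    qed
    have Xd: "X ^ d \<le> X ^ e" "(X ^ d) ^ c \<le> X ^ e"
      unfolding power_mult[symmetric] e_def using X1 by (auto intro!: power_increasing)
    have \<mu>n: "1 \<le> \<mu> ^ n" using \<mu>(1) by (simp add: one_le_power)
    have "real t1 \<le> real (K * (n + S) ^ d)"
      using t1(2) K(1)[OF x] unfolding n_def[symmetric] S_def[symmetric] of_nat_le_iff by linarith
    also have "\<dots> = real K * (1 * X ^ d)" by (simp add: X_def)
    also have "\<dots> \<le> real K * (\<mu> ^ n * X ^ e)"
      using Xd(1) \<mu>n X1 by (intro mult_left_mono mult_mono) auto
    finally have T1: "real t1 \<le> real K * (\<mu> ^ n * X ^ e)" .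
    have "real (input_size outp) \<le> real (K * (n + S) ^ d)"
      using input_size_outp K(2)[OF x] unfolding n_def[symmetric] S_def[symmetric] of_nat_le_iff
      by linarith
    also have "\<dots> = real K * X ^ d" by (simp add: X_def)
    finally have "real (input_size outp) ^ c \<le> (real K * X ^ d) ^ c" by (intro power_mono) auto
    also have "\<dots> \<le> real K ^ c * X ^ e"
      unfolding power_mult_distrib using Xd(2) by (intro mult_left_mono) auto
    finally have I: "real (input_size outp) ^ c \<le> real K ^ c * X ^ e" .
    have "\<kappa> ^ layout_cutwidth graph \<le> \<kappa> ^ (paths + (3 * (p * q) + 16))"
      using layout_cutwidth_graph \<kappa> by (intro power_increasing) auto
    also have "\<dots> = \<kappa> ^ (3 * (p * q) + 16) * \<mu> ^ (\<beta> * ((n + (\<beta> - 1)) div \<beta>))"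
      unfolding power_add paths_def power_mult \<mu>(2) by simp
    also have "\<dots> \<le> \<kappa> ^ (3 * (p * q) + 16) * \<mu> ^ (\<beta> + n)"
    proof (intro mult_left_mono power_increasing)
      have "\<beta> * ((n + (\<beta> - 1)) div \<beta>) \<le> n + (\<beta> - 1)" by simp
      then show "\<beta> * ((n + (\<beta> - 1)) div \<beta>) \<le> \<beta> + n" by linarith
    qed (use \<mu> \<kappa> in auto)
    finally have L: "\<kappa> ^ layout_cutwidth graph \<le> \<kappa> ^ (3 * (p * q) + 16) * \<mu> ^ \<beta> * \<mu> ^ n"
      by (simp add: power_add mult.assoc)
    have "real t2 \<le> C * ((\<kappa> ^ (3 * (p * q) + 16) * \<mu> ^ \<beta> * \<mu> ^ n) * (real K ^ c * X ^ e))"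
      using t2(3) mult_mono[OF L I] C \<kappa> \<mu>(1)
      by (smt (verit, best) mult_le_cancel_left_pos of_nat_0_le_iff mult_nonneg_nonneg zero_le_power)
    with T1 have "real (t1 + t2) \<le> A * (\<mu> ^ n * X ^ e)"
      unfolding A_def by (simp add: algebra_simps)
    also have "\<dots> \<le> A * (\<mu> ^ n * ((G * (\<nu> / \<mu>) ^ n) * real S ^ e))"
    proof -
      have "X ^ e \<le> (real (n + 1) * real S) ^ e" using XX X1 by (intro power_mono) auto
      also have "\<dots> \<le> (G * (\<nu> / \<mu>) ^ n) * real S ^ e"
        unfolding power_mult_distrib using G(2)[of n] by (intro mult_right_mono) auto
      finally show ?thesis using A \<mu>n by (intro mult_left_mono) auto
    qed
    also have "\<dots> = (A * G) * (\<nu> ^ n * real S ^ e)"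
      using \<mu>(1) by (simp add: power_divide)
    also have "\<dots> \<le> (A * G + 1) * (\<nu> ^ n * real S ^ e)"
      using \<mu>(1) \<nu> by (intro mult_right_mono) auto
    finally have "real (t1 + t2) \<le> (A * G + 1) * (\<nu> ^ num_vars x * real (input_size (encode_cnf x)) ^ e)"
      by (simp add: num_vars_def n_def S_def)
    moreover have "exec (Seq (reduction_prog p \<beta> q) P) (start (encode_cnf x)) (t1 + t2) s"
      using t1(1) t2(1) by (rule exec.Seq)
    moreover have "fst s 0 \<noteq> 0 \<longleftrightarrow> satisfiable x"
      using t2(2) graph_correct unfolding xx by blast
    ultimately show "\<exists>t s. exec (Seq (reduction_prog p \<beta> q) P) (start (encode_cnf x)) t s \<and>
        (fst s 0 \<noteq> 0 \<longleftrightarrow> satisfiable x) \<and>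
        real t \<le> (A * G + 1) * (\<nu> ^ num_vars x * real (input_size (encode_cnf x)) ^ e)" by blast
  qed
  moreover have "0 < A * G + 1" using A G(1) by (simp add: add_nonneg_pos)
  ultimately show ?thesis unfolding solvable_Ostar_def by blast
qed

theorem theorem7:
  assumes "SETH"
  shows "\<not> (\<exists>\<epsilon>::real. \<epsilon> > 0 \<and>
    solvable_Ostar ds_instances encode_ds has_dominating_set layout_cutwidth (\<lambda>k. (3 - \<epsilon>) ^ k))"
proof
  assume "\<exists>\<epsilon>::real. \<epsilon> > 0 \<and>
    solvable_Ostar ds_instances encode_ds has_dominating_set layout_cutwidth (\<lambda>k. (3 - \<epsilon>) ^ k)"
  then obtain \<epsilon> :: real where \<epsilon>: "\<epsilon> > 0" and
    sol: "solvable_Ostar ds_instances encode_ds has_dominating_set layout_cutwidth (\<lambda>k. (3 - \<epsilon>) ^ k)"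
    by blast
  have pos: "0 < 3 - \<epsilon>" using base_pos[OF sol] .
  \<comment> \<open>The maximum provides the lower bound required by
    \<open>grouping_parameters\<close>.\<close>
  define \<kappa> where "\<kappa> = max (3 - \<epsilon>) 2"
  have \<kappa>: "2 \<le> \<kappa>" "\<kappa> < 3" "3 - \<epsilon> \<le> \<kappa>" using \<epsilon> by (auto simp: \<kappa>_def)
  obtain P C c where C: "0 < C" and dec: "decides_within P ds_instances encode_ds has_dominating_set
      (\<lambda>x. C * ((3 - \<epsilon>) ^ layout_cutwidth x * real (input_size (encode_ds x)) ^ c))"
    using sol unfolding solvable_Ostar_def by blast
  have "C * ((3 - \<epsilon>) ^ k * real m ^ c) \<le> C * (\<kappa> ^ k * real m ^ c)" for k m
    using C pos \<kappa> by (intro mult_left_mono mult_right_mono power_mono) auto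
  then have dec': "decides_within P ds_instances encode_ds has_dominating_set
      (\<lambda>x. C * (\<kappa> ^ layout_cutwidth x * real (input_size (encode_ds x)) ^ c))"
    using dec unfolding decides_within_def by (meson order_trans)
  obtain p \<beta> \<mu> where par: "0 < p" "0 < \<beta>" "2 ^ \<beta> \<le> (3::nat) ^ p" "1 \<le> \<mu>" "\<mu> < 2" "\<mu> ^ \<beta> = \<kappa> ^ p"
    using grouping_parameters[OF \<kappa>(1,2)] by blast
  \<comment> \<open>Makes \<open>2 - \<delta>\<close> the midpoint of \<open>\<mu>\<close> and 2:
    below 2 as SETH requires, and strictly above \<open>\<mu>\<close> for the polynomial
    factor.\<close>
  define \<delta> where "\<delta> = (2 - \<mu>) / 2"
  have "0 < \<delta>" "\<mu> < 2 - \<delta>" using par by (auto simp: \<delta>_def field_simps)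
  then obtain q where
    "\<not> solvable_Ostar (qsat_instances q) encode_cnf satisfiable num_vars (\<lambda>n. (2 - \<delta>) ^ n)"
    using assms unfolding SETH_def by blast
  moreover have "1 \<le> \<kappa>" using \<kappa> by simp
  ultimately show False
    using qsat_solvable[OF dec' C _ par(1,2,3,4,6) \<open>\<mu> < 2 - \<delta>\<close>] by blast
qed

end
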